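(* Let $n,k \in \mathbb{N}$ with $n \geqslant 480k$. Then $$\frac{n-k+1}{2} \;\leqslant\; m(n,3,1,k) \;\leqslant\; \frac{n-k+1}{2} + 1.$$
   Context: A graph on at least $k+1$ vertices is $k$-connected if deleting any set of at most $k-1$ of its vertices leaves a connected graph. An $r$-colouring of $E(K_n)$ is a function $f:E(K_n)\to[r]$; a subgraph $H\subseteq K_n$ is monochromatic if $f$ is constant on $E(H)$. For $n\geqslant 2$ and $r,k\in\mathbb{N}$, $m(n,r,1,k)$ denotes the minimum, over all $r$-colourings $f$ of $E(K_n)$, of the maximum number of vertices of a monochromatic $k$-connected subgraph of $K_n$ (this maximum is $0$ if no such subgraph exists). *)

theory Defs
  imports "Graph_Theory.Graph_Theory" "HOL-Library.FuncSet" Complex_Main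
begin

text \<open>
  Finite simple graphs are the symmetric loop-free digraphs of \<^locale>\<open>pair_graph\<close>; an undirected
  edge is an unordered pair of vertices, standing for the two opposite arcs between them.
\<close>

definition edges :: "'a pair_pre_digraph \<Rightarrow> 'a set set" where
  "edges G = {{u, v} | u v. (u, v) \<in> parcs G}"

definition complete_graph :: "nat \<Rightarrow> nat pair_pre_digraph" where
  "complete_graph n = \<lparr> pverts = {..<n}, parcs = {(u, v). u < n \<and> v < n \<and> u \<noteq> v} \<rparr>"

lemma complete_digraph_complete_graph: "K\<^bsub>n\<^esub> (with_proj (complete_graph n))"
  by (auto simp: complete_digraph_pair_def complete_graph_def)

text \<open>
  The bound on the number of deleted vertices is written \<open>card S < k\<close> rather than
  \<open>card S \<le> k - 1\<close>, which would be wrong at \<open>k = 0\<close> because of truncated subtraction.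
\<close>

definition k_connected :: "nat \<Rightarrow> ('a, 'b) pre_digraph \<Rightarrow> bool" where
  "k_connected k G \<longleftrightarrow>
     card (verts G) \<ge> k + 1 \<and>
     (\<forall>S \<subseteq> verts G. card S < k \<longrightarrow> connected (G \<restriction> (verts G - S)))"

definition edge_colourings :: "nat \<Rightarrow> 'a pair_pre_digraph \<Rightarrow> ('a set \<Rightarrow> nat) set" where
  "edge_colourings r G = edges G \<rightarrow>\<^sub>E {1..r}"

definition monochromatic :: "('a set \<Rightarrow> nat) \<Rightarrow> 'a pair_pre_digraph \<Rightarrow> bool" where
  "monochromatic f H \<longleftrightarrow> (\<exists>c. \<forall>e \<in> edges H. f e = c)"

definition mono_k_connected_subgraphs ::
    "nat \<Rightarrow> (nat set \<Rightarrow> nat) \<Rightarrow> nat \<Rightarrow> nat pair_pre_digraph set" where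
  "mono_k_connected_subgraphs n f k =
     {H. pair_graph H \<and> subgraph (with_proj H) (with_proj (complete_graph n)) \<and>
         monochromatic f H \<and> k_connected k (with_proj H)}"

text \<open>Inserting \<open>0\<close> implements the convention for the case that there is no such subgraph.\<close>

definition max_mono_order :: "nat \<Rightarrow> (nat set \<Rightarrow> nat) \<Rightarrow> nat \<Rightarrow> nat" where
  "max_mono_order n f k =
     Max (insert 0 ((\<lambda>H. card (pverts H)) ` mono_k_connected_subgraphs n f k))"

text \<open>This is $m(n,r,1,k)$; the third argument $1$ (the number of colours a subgraph may use) is
  fixed. The minimum ranges over a nonempty set when \<open>r \<ge> 1\<close>.\<close>

definition m1 :: "nat \<Rightarrow> nat \<Rightarrow> nat \<Rightarrow> nat" where
  "m1 n r k = Min ((\<lambda>f. max_mono_order n f k) ` edge_colourings r (complete_graph n))"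

lemma card_pverts_le:
  assumes "H \<in> mono_k_connected_subgraphs n f k"
  shows "card (pverts H) \<le> n"
proof -
  have "pverts H \<subseteq> {..<n}"
    using assms by (auto simp: mono_k_connected_subgraphs_def subgraph_def complete_graph_def)
  from card_mono[OF _ this] show ?thesis by simp
qed

lemma finite_max_mono_order_set:
  "finite (insert 0 ((\<lambda>H. card (pverts H)) ` mono_k_connected_subgraphs n f k))"
  by (rule finite_subset[of _ "{..n}"]) (auto dest: card_pverts_le)

lemma finite_edge_colourings_complete_graph: "finite (edge_colourings r (complete_graph n))"
proof -
  have "edges (complete_graph n) \<subseteq> Pow {..<n}"
    by (auto simp: edges_def complete_graph_def)
  then have "finite (edges (complete_graph n))"
    by (rule finite_subset) simp
  then show ?thesis
    by (simp add: edge_colourings_def finite_PiE)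
qed

lemma edge_colourings_nonempty: "r \<ge> 1 \<Longrightarrow> edge_colourings r G \<noteq> {}"
  by (simp add: edge_colourings_def PiE_eq_empty_iff)

end

theory Submission
  imports Defs
begin

text \<open>
  Lower bound. Suppose every monochromatic \<open>k\<close>-connected subgraph has at most \<open>(n - k) / 2\<close>
  vertices. Mader's theorem, applied to the densest colour, gives a large maximal \<open>k\<close>-connected set
  \<open>Q\<close>, say red. Vertices of the complement \<open>P\<close> send fewer than \<open>k\<close> red edges to \<open>Q\<close>, so the bipartite graph
  between \<open>P\<close> and \<open>Q\<close> is almost 2-coloured, and Mader's theorem gives a large maximal blue \<open>k\<close>-connected
  set, splitting \<open>P\<close> and \<open>Q\<close> into \<open>P1\<close>, \<open>P2\<close> and \<open>Q1\<close>, \<open>Q2\<close>. By maximality the pairs \<open>(P2, Q1)\<close> and \<open>(P1, Q2)\<close> are almost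
  completely green. Two \<open>k\<close>-connected sets of one colour whose union is not \<open>k\<close>-connected have no
  edges of that colour between them outside some \<open>k - 1\<close> vertices. Using this once per colour, and
  deleting \<open>O(k)\<close> vertices, one obtains four blocks whose six pairs are complete in colours given by
  the three perfect matchings of \<open>K\<^sub>4\<close>. Attaching the remaining vertices to these six components and
  counting gives total size at least \<open>3 (n - k + 1)\<close>.

  Upper bound. Blow up this coloured \<open>K\<^sub>4\<close> and add for each colour \<open>k - 1\<close> vertices that are joined
  to all blocks in that colour; they can be deleted, which disconnects the two components.
\<close>

section \<open>Vertex connectivity of relations\<close>

text \<open>Connectivity in terms of cuts; the empty set counts as connected.\<close>

definition conn_on :: "('a \<times> 'a) set \<Rightarrow> 'a set \<Rightarrow> bool" where
  "conn_on E A \<longleftrightarrow> (\<forall>X\<subseteq>A. X \<noteq> {} \<longrightarrow> X \<noteq> A \<longrightarrow> (\<exists>x\<in>X. \<exists>y\<in>A - X. (x, y) \<in> E))"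

definition kconn_on :: "nat \<Rightarrow> ('a \<times> 'a) set \<Rightarrow> 'a set \<Rightarrow> bool" where
  "kconn_on k E A \<longleftrightarrow> k + 1 \<le> card A \<and> (\<forall>S\<subseteq>A. card S < k \<longrightarrow> conn_on E (A - S))"

lemma conn_onI:
  assumes "\<And>X. \<lbrakk>X \<subseteq> A; X \<noteq> {}; X \<noteq> A; \<And>x y. x \<in> X \<Longrightarrow> y \<in> A - X \<Longrightarrow> (x, y) \<notin> E\<rbrakk> \<Longrightarrow> False"
  shows "conn_on E A"
  using assms unfolding conn_on_def by blast

lemma conn_onE:
  assumes "conn_on E A" "X \<subseteq> A" "X \<noteq> {}" "X \<noteq> A"
  obtains x y where "x \<in> X" "y \<in> A - X" "(x, y) \<in> E"
  using assms unfolding conn_on_def by blast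

lemma conn_on_mono: "conn_on E A \<Longrightarrow> E \<subseteq> F \<Longrightarrow> conn_on F A"
  unfolding conn_on_def by blast

text \<open>If \<open>A\<close> met both \<open>X\<close> and its complement, the cut
  \<open>A \<inter> X\<close> of \<open>A\<close> would be crossed by an arc, and that arc would
  leave \<open>X\<close> inside \<open>B\<close>. The gluing lemmas below apply this to the parts of
  a union.\<close>

lemma conn_on_trivial_trace:
  assumes "conn_on E A" and "\<And>x y. x \<in> X \<Longrightarrow> y \<in> B - X \<Longrightarrow> (x, y) \<notin> E" and "A \<subseteq> B"
  shows "A \<subseteq> X \<or> A \<inter> X = {}"
proof (rule ccontr)
  assume *: "\<not> (A \<subseteq> X \<or> A \<inter> X = {})"
  have "A \<inter> X \<subseteq> A" "A \<inter> X \<noteq> {}" "A \<inter> X \<noteq> A" using * by auto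
  then obtain x y where "x \<in> A \<inter> X" "y \<in> A - A \<inter> X" "(x, y) \<in> E"
    by (rule conn_onE[OF assms(1)])
  then show False using assms(2)[of x y] assms(3) by auto
qed

lemma conn_on_Un_overlap:
  assumes "conn_on E A" "conn_on E B" "A \<inter> B \<noteq> {}"
  shows "conn_on E (A \<union> B)"
proof (rule conn_onI)
  fix X assume X: "X \<subseteq> A \<union> B" "X \<noteq> {}" "X \<noteq> A \<union> B"
    and no: "\<And>x y. x \<in> X \<Longrightarrow> y \<in> A \<union> B - X \<Longrightarrow> (x, y) \<notin> E"
  have "A \<subseteq> X \<or> A \<inter> X = {}"
    by (rule conn_on_trivial_trace[OF assms(1), where B = "A \<union> B"]) (use no in auto)
  moreover have "B \<subseteq> X \<or> B \<inter> X = {}"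
    by (rule conn_on_trivial_trace[OF assms(2), where B = "A \<union> B"]) (use no in auto)
  ultimately show False using X assms(3) by blast
qed

lemma conn_on_Un_edge:
  assumes "conn_on E A" "conn_on E B" "sym E" "a \<in> A" "b \<in> B" "(a, b) \<in> E"
  shows "conn_on E (A \<union> B)"
proof (rule conn_onI)
  fix X assume X: "X \<subseteq> A \<union> B" "X \<noteq> {}" "X \<noteq> A \<union> B"
    and no: "\<And>x y. x \<in> X \<Longrightarrow> y \<in> A \<union> B - X \<Longrightarrow> (x, y) \<notin> E"
  have A: "A \<subseteq> X \<or> A \<inter> X = {}"
    by (rule conn_on_trivial_trace[OF assms(1), where B = "A \<union> B"]) (use no in auto)
  have B: "B \<subseteq> X \<or> B \<inter> X = {}"
    by (rule conn_on_trivial_trace[OF assms(2), where B = "A \<union> B"]) (use no in auto)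
  have "(b, a) \<in> E" by (rule symD[OF assms(3,6)])
  then have "a \<in> X \<longleftrightarrow> b \<in> X" using no[of a b] no[of b a] assms(4-6) by blast
  then show False using X A B assms(4,5) by blast
qed

text \<open>\<open>A\<close> lies on one side of any cut without crossing arcs, and each vertex of
  \<open>B\<close> is pulled to that side by a neighbour.\<close>

lemma conn_on_attach:
  assumes "conn_on E A" "sym E" "\<And>v. v \<in> B \<Longrightarrow> \<exists>u\<in>A. (v, u) \<in> E"
  shows "conn_on E (A \<union> B)"
proof (rule conn_onI)
  fix X assume X: "X \<subseteq> A \<union> B" "X \<noteq> {}" "X \<noteq> A \<union> B"
    and no: "\<And>x y. x \<in> X \<Longrightarrow> y \<in> A \<union> B - X \<Longrightarrow> (x, y) \<notin> E"
  have A: "A \<subseteq> X \<or> A \<inter> X = {}"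
    by (rule conn_on_trivial_trace[OF assms(1), where B = "A \<union> B"]) (use no in auto)
  have "v \<in> X \<longleftrightarrow> A \<subseteq> X" if v: "v \<in> B" for v
  proof -
    obtain u where u: "u \<in> A" "(v, u) \<in> E" using assms(3)[OF v] by blast
    from symD[OF assms(2) u(2)] have "(u, v) \<in> E" .
    then show ?thesis using no[of u v] no[of v u] u v A by blast
  qed
  then show False using X A by blast
qed

text \<open>In a cut without crossing arcs, common neighbours put all of \<open>X\<close> on one
  side, and each vertex of \<open>Y\<close> follows a neighbour in \<open>X\<close>.\<close>

lemma conn_on_common_neighbours:
  assumes "sym E" "X \<noteq> {}" "\<And>x x'. x \<in> X \<Longrightarrow> x' \<in> X \<Longrightarrow> \<exists>y\<in>Y. (x, y) \<in> E \<and> (x', y) \<in> E"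
    "\<And>y. y \<in> Y \<Longrightarrow> \<exists>x\<in>X. (y, x) \<in> E"
  shows "conn_on E (X \<union> Y)"
proof (rule conn_onI)
  fix Z assume Z: "Z \<subseteq> X \<union> Y" "Z \<noteq> {}" "Z \<noteq> X \<union> Y"
    and no: "\<And>x y. x \<in> Z \<Longrightarrow> y \<in> X \<union> Y - Z \<Longrightarrow> (x, y) \<notin> E"
  have eq: "u \<in> Z \<longleftrightarrow> v \<in> Z" if "u \<in> X \<union> Y" "v \<in> X \<union> Y" "(u, v) \<in> E" for u v
    using no[of u v] no[of v u] that symD[OF assms(1) that(3)] by blast
  have XZ: "x \<in> Z \<longleftrightarrow> x' \<in> Z" if "x \<in> X" "x' \<in> X" for x x'
    using assms(3)[OF that] eq that by (metis UnI1 UnI2)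
  have YZ: "\<exists>x\<in>X. y \<in> Z \<longleftrightarrow> x \<in> Z" if "y \<in> Y" for y
    using assms(4)[OF that] eq that by (metis UnI1 UnI2)
  show False using Z assms(2) XZ YZ by blast
qed

section \<open>Closure properties of highly connected sets\<close>

lemma kconn_onD: "kconn_on k E A \<Longrightarrow> card S < k \<Longrightarrow> S \<subseteq> A \<Longrightarrow> conn_on E (A - S)"
  unfolding kconn_on_def by blast

lemma kconn_on_finite: "kconn_on k E A \<Longrightarrow> finite A"
  unfolding kconn_on_def by (rule card_ge_0_finite) linarith

lemma kconn_on_card: "kconn_on k E A \<Longrightarrow> k < card A"
  unfolding kconn_on_def by simp

lemma kconn_onD':
  assumes "kconn_on k E A" "card S < k" "finite S"
  shows "conn_on E (A - S)"
proof -
  have "card (A \<inter> S) \<le> card S" using assms(3) by (intro card_mono) auto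
  then have "conn_on E (A - A \<inter> S)" using assms by (intro kconn_onD[of k]) auto
  then show ?thesis by (simp add: Diff_Int)
qed

lemma kconn_on_mono: "kconn_on k E A \<Longrightarrow> E \<subseteq> F \<Longrightarrow> kconn_on k F A"
  unfolding kconn_on_def using conn_on_mono by blast

text \<open>Fewer than \<open>k\<close> deleted vertices cannot exhaust \<open>A \<inter> B\<close>,
  so the two connected remainders still meet.\<close>

lemma kconn_on_Un_overlap:
  assumes "kconn_on k E A" "kconn_on k E B" "k \<le> card (A \<inter> B)"
  shows "kconn_on k E (A \<union> B)"
  unfolding kconn_on_def
proof (intro conjI allI impI)
  have fin: "finite A" "finite B" using assms kconn_on_finite by auto
  have "card A \<le> card (A \<union> B)" using fin by (intro card_mono) auto
  then show "k + 1 \<le> card (A \<union> B)" using kconn_on_card[OF assms(1)] by simp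
  fix S assume S: "S \<subseteq> A \<union> B" "card S < k"
  have fS: "finite S" using S fin finite_subset by blast
  have "(A - S) \<inter> (B - S) \<noteq> {}"
  proof
    assume "(A - S) \<inter> (B - S) = {}"
    then have "A \<inter> B \<subseteq> S" by blast
    then have "card (A \<inter> B) \<le> card S" using fS by (rule card_mono[rotated])
    then show False using S assms(3) by simp
  qed
  moreover have "conn_on E (A - S)" "conn_on E (B - S)"
    using assms(1,2) S fS by (auto intro: kconn_onD')
  ultimately have "conn_on E ((A - S) \<union> (B - S))" by (intro conn_on_Un_overlap)
  then show "conn_on E (A \<union> B - S)" by (simp add: Un_Diff)
qed

text \<open>A deleted set \<open>S\<close> that disconnects the union leaves both
  \<open>A - S\<close> and \<open>B - S\<close> connected, so a single arc between them would
  reconnect it.\<close>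

lemma kconn_on_Un_or_separator:
  assumes "kconn_on k E A" "kconn_on k E B" "sym E" "\<not> kconn_on k E (A \<union> B)"
  obtains S where "finite S" "card S < k" "\<And>a b. a \<in> A - S \<Longrightarrow> b \<in> B - S \<Longrightarrow> (a, b) \<notin> E"
proof -
  have fin: "finite A" "finite B" using assms kconn_on_finite by auto
  have "card A \<le> card (A \<union> B)" using fin by (intro card_mono) auto
  then have "k + 1 \<le> card (A \<union> B)" using kconn_on_card[OF assms(1)] by simp
  then obtain S where S: "S \<subseteq> A \<union> B" "card S < k" "\<not> conn_on E (A \<union> B - S)"
    using assms(4) unfolding kconn_on_def by blast
  have fS: "finite S" using S fin finite_subset by blast
  have "conn_on E (A - S)" "conn_on E (B - S)"
    using assms(1,2) S fS by (auto intro: kconn_onD')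
  then have "(a, b) \<notin> E" if "a \<in> A - S" "b \<in> B - S" for a b
    using conn_on_Un_edge[of E "A - S" "B - S" a b] that S assms(3) by (auto simp: Un_Diff)
  then show thesis using that fS S by blast
qed

lemma kconn_on_attach:
  assumes "kconn_on k E A" "sym E" "finite B" "\<And>v. v \<in> B \<Longrightarrow> k \<le> card {u \<in> A. (v, u) \<in> E}"
  shows "kconn_on k E (A \<union> B)"
  unfolding kconn_on_def
proof (intro conjI allI impI)
  have fin: "finite A" using assms kconn_on_finite by auto
  have "card A \<le> card (A \<union> B)" using fin assms by (intro card_mono) auto
  then show "k + 1 \<le> card (A \<union> B)" using kconn_on_card[OF assms(1)] by simp
  fix S assume S: "S \<subseteq> A \<union> B" "card S < k"
  have fS: "finite S" using S fin finite_subset assms by blast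
  have "conn_on E (A - S)" using assms(1) S fS by (auto intro: kconn_onD')
  moreover have "\<exists>u\<in>A - S. (v, u) \<in> E" if "v \<in> B - S" for v
  proof (rule ccontr)
    assume "\<not> ?thesis"
    then have "{u \<in> A. (v, u) \<in> E} \<subseteq> S" by blast
    then have "card {u \<in> A. (v, u) \<in> E} \<le> card S" using fS by (rule card_mono[rotated])
    then show False using assms(4)[of v] that S by simp
  qed
  ultimately have "conn_on E ((A - S) \<union> (B - S))" using assms(2) by (intro conn_on_attach)
  then show "conn_on E (A \<union> B - S)" by (simp add: Un_Diff)
qed

text \<open>With \<open>k\<close> common neighbours per pair, the hypotheses of
  \<open>conn_on_common_neighbours\<close> survive the deletion of fewer than \<open>k\<close>
  vertices.\<close>

lemma kconn_on_common_neighbours: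
  assumes "sym E" "finite X" "finite Y" "k < card X"
    "\<And>x x'. x \<in> X \<Longrightarrow> x' \<in> X \<Longrightarrow> k \<le> card {y \<in> Y. (x, y) \<in> E \<and> (x', y) \<in> E}"
    "\<And>y. y \<in> Y \<Longrightarrow> k \<le> card {x \<in> X. (y, x) \<in> E}"
  shows "kconn_on k E (X \<union> Y)"
  unfolding kconn_on_def
proof (intro conjI allI impI)
  have "card X \<le> card (X \<union> Y)" using assms by (intro card_mono) auto
  then show "k + 1 \<le> card (X \<union> Y)" using assms by simp
  fix S assume S: "S \<subseteq> X \<union> Y" "card S < k"
  have fS: "finite S" using S finite_subset assms by blast
  have large: "\<exists>z\<in>Z. z \<notin> S" if "k \<le> card Z" for Z
  proof (rule ccontr)
    assume "\<not> ?thesis"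
    then have "card Z \<le> card S" using fS by (intro card_mono) auto
    then show False using that S by simp
  qed
  have "conn_on E ((X - S) \<union> (Y - S))"
  proof (rule conn_on_common_neighbours)
    show "sym E" by fact
    show "X - S \<noteq> {}" using large[of X] assms(4) by auto
    show "\<exists>y\<in>Y - S. (x, y) \<in> E \<and> (x', y) \<in> E" if "x \<in> X - S" "x' \<in> X - S" for x x'
      using large[OF assms(5)[of x x']] that by auto
    show "\<exists>x\<in>X - S. (y, x) \<in> E" if "y \<in> Y - S" for y
      using large[OF assms(6)[of y]] that by auto
  qed
  then show "conn_on E (X \<union> Y - S)" by (simp add: Un_Diff)
qed

lemma kconn_on_complete_bipartite:
  assumes "sym E" "finite X" "finite Y" "k < card X" "k \<le> card Y" "X \<times> Y \<subseteq> E"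
  shows "kconn_on k E (X \<union> Y)"
proof (rule kconn_on_common_neighbours)
  have "{y \<in> Y. (x, y) \<in> E \<and> (x', y) \<in> E} = Y" if "x \<in> X" "x' \<in> X" for x x'
    using that assms(6) by auto
  then show "k \<le> card {y \<in> Y. (x, y) \<in> E \<and> (x', y) \<in> E}" if "x \<in> X" "x' \<in> X" for x x'
    using that assms(5) by simp
  have "{x \<in> X. (y, x) \<in> E} = X" if "y \<in> Y" for y
    using that assms(6) symD[OF assms(1)] by blast
  then show "k \<le> card {x \<in> X. (y, x) \<in> E}" if "y \<in> Y" for y
    using that assms(4) by simp
qed (use assms in auto)

section \<open>Near-complete bipartite graphs and Mader's theorem\<close>

text \<open>Double counting of \<open>R\<close> between the heavy rows and \<open>Y\<close>: each
  heavy row contributes more than a quarter of \<open>card Y\<close>, each column at most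
  \<open>m\<close>.\<close>

lemma card_large_rows_le:
  assumes "finite X" "finite Y" "\<And>y. y \<in> Y \<Longrightarrow> card {x \<in> X. (x, y) \<in> R} \<le> m"
  shows "card {x \<in> X. card Y < 4 * card {y \<in> Y. (x, y) \<in> R}} \<le> 4 * m"
proof -
  define B where "B = {x \<in> X. card Y < 4 * card {y \<in> Y. (x, y) \<in> R}}"
  have fB: "finite B" unfolding B_def using assms by simp
  have "card B * card Y \<le> (\<Sum>x\<in>B. 4 * card {y \<in> Y. (x, y) \<in> R})"
    using sum_bounded_below[of B "card Y" "\<lambda>x. 4 * card {y \<in> Y. (x, y) \<in> R}"]
    unfolding B_def by force
  also have "\<dots> = 4 * (\<Sum>x\<in>B. \<Sum>y\<in>Y. if (x, y) \<in> R then 1 else 0)"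
    using assms(2) by (simp add: sum_distrib_left sum.If_cases Int_def)
  also have "\<dots> = 4 * (\<Sum>y\<in>Y. \<Sum>x\<in>B. if (x, y) \<in> R then 1 else 0)"
    by (subst sum.swap) simp
  also have "\<dots> = 4 * (\<Sum>y\<in>Y. card {x \<in> B. (x, y) \<in> R})"
    using fB by (simp add: sum.If_cases Int_def)
  also have "\<dots> \<le> 4 * (\<Sum>y\<in>Y. m)"
  proof (intro mult_le_mono2 sum_mono)
    fix y assume "y \<in> Y"
    have "card {x \<in> B. (x, y) \<in> R} \<le> card {x \<in> X. (x, y) \<in> R}"
      using assms(1) unfolding B_def by (intro card_mono) auto
    then show "card {x \<in> B. (x, y) \<in> R} \<le> m" using assms(3)[OF \<open>y \<in> Y\<close>] by linarith
  qed
  finally have *: "card B * card Y \<le> (4 * m) * card Y" by simp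
  show ?thesis
  proof (cases "card Y = 0")
    case True
    then have "Y = {}" using assms(2) by simp
    then show ?thesis by simp
  next
    case False
    then show ?thesis using * unfolding B_def by simp
  qed
qed

text \<open>Discard the vertices of \<open>X\<close> that are \<open>R'\<close>-related to more than
  a quarter of \<open>Y\<close>, and the vertices of \<open>Y\<close> that are
  \<open>R\<close>-related to more than a quarter of \<open>X\<close>; double counting bounds the
  loss. Two kept vertices of \<open>X\<close> then miss at most \<open>2 * r\<close> plus half of
  \<open>Y\<close>, and \<open>Y'\<close> lacks at most \<open>4 * r\<close> vertices, so
  \<open>12 * r + 2 * k\<close> vertices in \<open>Y\<close> leave \<open>k\<close> common
  neighbours. A kept vertex of \<open>Y\<close> misses at most \<open>r'\<close> plus a quarter of
  \<open>X\<close>, which explains the weaker bound on \<open>card X\<close>.\<close>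

lemma kconn_on_near_complete_bipartite:
  assumes "sym E" "finite X" "finite Y" "1 \<le> k"
    and cover: "\<And>x y. x \<in> X \<Longrightarrow> y \<in> Y \<Longrightarrow> (x, y) \<in> E \<or> (x, y) \<in> R \<or> (x, y) \<in> R'"
    and R: "\<And>x. x \<in> X \<Longrightarrow> card {y \<in> Y. (x, y) \<in> R} \<le> r"
    and R': "\<And>y. y \<in> Y \<Longrightarrow> card {x \<in> X. (x, y) \<in> R'} \<le> r'"
    and size: "12 * r + 2 * k \<le> card Y" "7 * r' + 2 * k \<le> card X"
  obtains X' Y' where "X' \<subseteq> X" "Y' \<subseteq> Y" "card (X - X') \<le> 4 * r'" "card (Y - Y') \<le> 4 * r"
    "kconn_on k E (X' \<union> Y')"
proof -
  define X' where "X' = {x \<in> X. 4 * card {y \<in> Y. (x, y) \<in> R'} \<le> card Y}"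
  define Y' where "Y' = {y \<in> Y. 4 * card {x \<in> X. (x, y) \<in> R} \<le> card X}"
  have sub: "X' \<subseteq> X" "Y' \<subseteq> Y" unfolding X'_def Y'_def by auto
  then have fin: "finite X'" "finite Y'" using assms(2,3) finite_subset by auto
  have "X - X' = {x \<in> X. card Y < 4 * card {y \<in> Y. (x, y) \<in> R'}}" unfolding X'_def by auto
  then have cX: "card (X - X') \<le> 4 * r'" using card_large_rows_le[OF assms(2,3) R'] by simp
  have "Y - Y' = {y \<in> Y. card X < 4 * card {x \<in> X. (y, x) \<in> R\<inverse>}}" unfolding Y'_def by auto
  then have cY: "card (Y - Y') \<le> 4 * r"
    using card_large_rows_le[OF assms(3,2), of "R\<inverse>" r] R by simp
  have cX': "card X \<le> card X' + 4 * r'" and cY': "card Y \<le> card Y' + 4 * r"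
    using cX cY sub fin card_Diff_subset[of X' X] card_Diff_subset[of Y' Y] by linarith+
  have "kconn_on k E (X' \<union> Y')"
  proof (rule kconn_on_common_neighbours)
    show "k < card X'" using cX' size assms(4) by linarith
    fix x x' assume x: "x \<in> X'" "x' \<in> X'"
    let ?C = "{y \<in> Y'. (x, y) \<in> E \<and> (x', y) \<in> E}"
    let ?R = "\<lambda>x. {y \<in> Y. (x, y) \<in> R}" and ?R' = "\<lambda>x. {y \<in> Y. (x, y) \<in> R'}"
    have "Y' \<subseteq> ?C \<union> (?R x \<union> ?R' x) \<union> (?R x' \<union> ?R' x')"
      using cover x sub by blast
    then have "card Y' \<le> card (?C \<union> (?R x \<union> ?R' x) \<union> (?R x' \<union> ?R' x'))"
      using fin assms(3) by (intro card_mono) auto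
    also have "\<dots> \<le> card ?C + (card (?R x) + card (?R' x)) + (card (?R x') + card (?R' x'))"
      by (meson add_le_mono card_Un_le le_refl le_trans)
    finally show "k \<le> card ?C"
      using x R[of x] R[of x'] cY' size unfolding X'_def by auto
  next
    fix y assume y: "y \<in> Y'"
    let ?C = "{x \<in> X'. (y, x) \<in> E}"
    let ?R = "{x \<in> X. (x, y) \<in> R}" and ?R' = "{x \<in> X. (x, y) \<in> R'}"
    have "X' \<subseteq> ?C \<union> ?R \<union> ?R'"
    proof
      fix x assume x: "x \<in> X'"
      then show "x \<in> ?C \<union> ?R \<union> ?R'"
        using cover[of x y] y sub symD[OF assms(1), of x y] by blast
    qed
    then have "card X' \<le> card (?C \<union> ?R \<union> ?R')"
      using fin assms(2) by (intro card_mono) auto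
    also have "\<dots> \<le> card ?C + card ?R + card ?R'"
      by (meson add_le_mono card_Un_le le_refl le_trans)
    finally show "k \<le> card ?C"
      using y R'[of y] cX' size unfolding Y'_def by auto
  qed (use assms fin in auto)
  then show thesis using that sub cX cY by blast
qed

text \<open>Arcs count each edge twice, so \<open>d\<close> bounds the average degree from below.
  Among the sets with at least \<open>2 * k\<close> vertices and more than
  \<open>d * (card W - k)\<close> arcs, one of least size works: removing a vertex of low degree, or
  passing to one side of a small separator, would give a smaller such set.\<close>

lemma mader_highly_connected_subgraph:
  assumes "finite V" "sym E" "\<And>v. (v, v) \<notin> E" "1 \<le> k" "4 * k \<le> d" "2 * k \<le> card V"
    "d * card V \<le> card (E \<inter> V \<times> V)"
  obtains W where "W \<subseteq> V" "kconn_on k E W" "\<And>v. v \<in> W \<Longrightarrow> d < 2 * card {u \<in> W. (v, u) \<in> E}"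
    "d * card W < card (E \<inter> W \<times> W) + d * k"
proof -
  define arcs where "arcs W = card (E \<inter> W \<times> W)" for W
  define P where "P W \<longleftrightarrow> W \<subseteq> V \<and> 2 * k \<le> card W \<and> d * card W < arcs W + d * k" for W
  have "0 < d * k" using assms(4,5) by simp
  then have "P V" using assms(6,7) unfolding P_def arcs_def by (auto intro: le_less_trans)
  then obtain W where W: "P W" and least: "\<And>U. P U \<Longrightarrow> card W \<le> card U"
    using ex_has_least_nat[of P V card] by blast
  have WV: "W \<subseteq> V" and W2k: "2 * k \<le> card W" and Wd: "d * card W < arcs W + d * k"
    using W unfolding P_def by auto
  have fW: "finite W" using WV assms(1) finite_subset by blast
  have sparse: "arcs U + d * k \<le> d * card U" if "U \<subset> W" "2 * k \<le> card U" for U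
  proof -
    have "\<not> P U" using least[of U] psubset_card_mono[OF fW that(1)] by auto
    then show ?thesis using that WV unfolding P_def by auto
  qed
  \<comment> \<open>A set of \<open>2 * k\<close> vertices has at most
    \<open>4 * k * k <= d * k\<close> arcs, too few for \<open>W\<close>. Hence one vertex can be
    removed without falling below \<open>2 * k\<close>.\<close>
  have "card W \<noteq> 2 * k"
  proof
    assume eq: "card W = 2 * k"
    have "arcs W \<le> card (W \<times> W)" unfolding arcs_def using fW by (intro card_mono) auto
    then have "arcs W \<le> 4 * k * k" using eq by (simp add: card_cartesian_product)
    also have "\<dots> \<le> d * k" using assms(5) by simp
    finally show False using Wd eq by simp
  qed
  then have W2k': "2 * k < card W" using W2k by simp
  \<comment> \<open>Removing \<open>v\<close> destroys at most twice its degree in arcs and lowers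
    \<open>d * card W\<close> by \<open>d\<close>; sparsity of the smaller set forces the degree
    above \<open>d / 2\<close>.\<close>
  have degree: "d < 2 * card {u \<in> W. (v, u) \<in> E}" if v: "v \<in> W" for v
  proof -
    let ?N = "{u \<in> W. (v, u) \<in> E}"
    have card: "card W = card (W - {v}) + 1"
      using card.remove[OF fW v] by simp
    have "(v, u) \<in> E" if "(u, v) \<in> E" for u using symD[OF assms(2) that] .
    then have "E \<inter> W \<times> W \<subseteq> E \<inter> (W - {v}) \<times> (W - {v}) \<union> ({v} \<times> ?N \<union> ?N \<times> {v})"
      by auto
    then have "arcs W \<le> card (E \<inter> (W - {v}) \<times> (W - {v}) \<union> ({v} \<times> ?N \<union> ?N \<times> {v}))"
      unfolding arcs_def using fW by (intro card_mono) auto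
    also have "\<dots> \<le> arcs (W - {v}) + (card ({v} \<times> ?N) + card (?N \<times> {v}))"
      unfolding arcs_def by (meson add_le_mono card_Un_le le_refl le_trans)
    also have "\<dots> = arcs (W - {v}) + 2 * card ?N"
      by (simp add: card_cartesian_product)
    finally have "arcs W \<le> arcs (W - {v}) + 2 * card ?N" .
    moreover have "arcs (W - {v}) + d * k \<le> d * card (W - {v})"
    proof (rule sparse)
      show "W - {v} \<subset> W" using v by blast
      show "2 * k \<le> card (W - {v})" using W2k' card by linarith
    qed
    moreover have "d * card W = d * card (W - {v}) + d" unfolding card by (simp only: algebra_simps)
    ultimately show ?thesis using Wd by linarith
  qed
  have "kconn_on k E W"
    unfolding kconn_on_def
  proof (intro conjI allI impI conn_onI)
    show "k + 1 \<le> card W" using W2k' assms(4) by simp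
    fix S X assume S: "S \<subseteq> W" "card S < k" and X: "X \<subseteq> W - S" "X \<noteq> {}" "X \<noteq> W - S"
      and no: "\<And>x y. x \<in> X \<Longrightarrow> y \<in> W - S - X \<Longrightarrow> (x, y) \<notin> E"
    define Y where "Y = W - S - X"
    have "finite X" using X(1) fW finite_subset[of X W] by blast
    moreover have "finite S" using S(1) fW finite_subset by blast
    moreover have "finite Y" unfolding Y_def using fW by simp
    ultimately have fin: "finite X" "finite S" "finite Y" by simp_all
    have no': "(x, y) \<notin> E" "(y, x) \<notin> E" if "x \<in> X" "y \<in> Y" for x y
      using no[of x y] symD[OF assms(2), of y x] that unfolding Y_def by auto
    \<comment> \<open>A vertex of \<open>Z\<close> has all its neighbours in
      \<open>Z \<union> S\<close>, so this set has more than \<open>d / 2 >= 2 * k\<close> vertices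
      and falls under \<open>sparse\<close>.\<close>
    have half: "arcs (Z \<union> S) + d * k \<le> d * card (Z \<union> S)"
      if Z: "Z \<subseteq> W - S" "Z \<noteq> {}" "Z \<noteq> W - S"
        and closed: "\<And>x y. x \<in> Z \<Longrightarrow> y \<in> W - S - Z \<Longrightarrow> (x, y) \<notin> E" for Z
    proof (rule sparse)
      show "Z \<union> S \<subset> W" using Z S by blast
      obtain v where v: "v \<in> Z" using Z by blast
      have "finite (Z \<union> S)" using fW Z S by (intro finite_subset[of "Z \<union> S" W]) auto
      moreover have "{u \<in> W. (v, u) \<in> E} \<subseteq> Z \<union> S" using closed[OF v] by blast
      ultimately have "card {u \<in> W. (v, u) \<in> E} \<le> card (Z \<union> S)" by (rule card_mono)
      then show "2 * k \<le> card (Z \<union> S)" using degree[of v] v Z assms(5) by auto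
    qed
    have hX: "arcs (X \<union> S) + d * k \<le> d * card (X \<union> S)"
      using X no by (intro half) auto
    have hY: "arcs (Y \<union> S) + d * k \<le> d * card (Y \<union> S)"
      using X no' unfolding Y_def by (intro half) auto
    have "E \<inter> W \<times> W \<subseteq> (E \<inter> (X \<union> S) \<times> (X \<union> S)) \<union> (E \<inter> (Y \<union> S) \<times> (Y \<union> S))"
      using no' unfolding Y_def by blast
    then have "arcs W \<le> card ((E \<inter> (X \<union> S) \<times> (X \<union> S)) \<union> (E \<inter> (Y \<union> S) \<times> (Y \<union> S)))"
      unfolding arcs_def using fin by (intro card_mono) auto
    also have "\<dots> \<le> arcs (X \<union> S) + arcs (Y \<union> S)"
      unfolding arcs_def by (rule card_Un_le)
    finally have aW: "arcs W \<le> arcs (X \<union> S) + arcs (Y \<union> S)" .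
    have "card (X \<union> S) = card X + card S" "card (Y \<union> S) = card Y + card S"
      using fin X by (auto intro!: card_Un_disjoint simp: Y_def)
    moreover have "card W = card X + card Y + card S"
    proof -
      have "W = X \<union> Y \<union> S" using X S unfolding Y_def by blast
      moreover have "card (X \<union> Y \<union> S) = card X + card Y + card S"
        using fin X by (subst card_Un_disjoint; (subst card_Un_disjoint)?) (auto simp: Y_def)
      ultimately show ?thesis by simp
    qed
    \<comment> \<open>The two sparsity bounds together gain \<open>2 * d * k\<close>, while counting
      \<open>S\<close> twice costs at most \<open>d * k\<close>. The balance contradicts the number
      of arcs of \<open>W\<close>.\<close>
    ultimately have "d * card (X \<union> S) + d * card (Y \<union> S) = d * card W + d * card S"
      by (simp add: algebra_simps)
    moreover have "d * card S \<le> d * k" using S by simp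
    ultimately show False using aW hX hY Wd by linarith
  qed
  then show thesis using that[of W] WV degree Wd unfolding arcs_def by blast
qed

section \<open>Three-colourings without large highly connected sets\<close>

lemma card_le_card_Diff_add:
  assumes "finite S" "card S < k"
  shows "card A \<le> card (A - S) + k"
  using diff_card_le_card_Diff[OF assms(1), of A] assms(2) by linarith

lemma card_subset_add_card_Diff:
  assumes "finite A" "B \<subseteq> A"
  shows "card A = card B + card (A - B)"
  using assms card_Diff_subset[of B A] card_mono[of A B] finite_subset[of B A] by simp

lemma card_Un4_disjoint:
  assumes "finite A" "finite B" "finite C" "finite D" "A \<inter> B = {}" "A \<inter> C = {}" "A \<inter> D = {}"
    "B \<inter> C = {}" "B \<inter> D = {}" "C \<inter> D = {}"
  shows "card (A \<union> B \<union> C \<union> D) = card A + card B + card C + card D"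
proof -
  have "card (A \<union> B \<union> C \<union> D) = card (A \<union> B \<union> C) + card D"
    using assms by (intro card_Un_disjoint) auto
  moreover have "card (A \<union> B \<union> C) = card (A \<union> B) + card C"
    using assms by (intro card_Un_disjoint) auto
  moreover have "card (A \<union> B) = card A + card B"
    using assms by (intro card_Un_disjoint) auto
  ultimately show ?thesis by simp
qed

text \<open>The situation to be refuted for the lower bound, with one symmetric relation per colour:
  every \<open>k\<close>-connected set in one colour has at most \<open>(card V - k) / 2\<close>
  vertices.\<close>

locale no_large_kconn =
  fixes V :: "'a set" and E :: "'c \<Rightarrow> ('a \<times> 'a) set" and k :: nat
  assumes finite_V: "finite V" and k_pos: "1 \<le> k" and card_V: "480 * k \<le> card V"
    and sym_E: "sym (E c)" and irrefl_E: "(v, v) \<notin> E c"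
    and small: "\<lbrakk>W \<subseteq> V; kconn_on k (E c) W\<rbrakk> \<Longrightarrow> 2 * card W + k \<le> card V"
begin

text \<open>The three colours are arguments, so that their roles can be permuted.\<close>

definition palette :: "'c \<Rightarrow> 'c \<Rightarrow> 'c \<Rightarrow> bool" where
  "palette r b g \<longleftrightarrow> (\<forall>u\<in>V. \<forall>v\<in>V. u \<noteq> v \<longrightarrow> (u, v) \<in> E r \<or> (u, v) \<in> E b \<or> (u, v) \<in> E g)"

lemma paletteD:
  "palette r b g \<Longrightarrow> u \<in> V \<Longrightarrow> v \<in> V \<Longrightarrow> u \<noteq> v \<Longrightarrow> (u, v) \<in> E r \<or> (u, v) \<in> E b \<or> (u, v) \<in> E g"
  unfolding palette_def by blast

lemma fin: "A \<subseteq> V \<Longrightarrow> finite A"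
  using finite_V finite_subset by blast

text \<open>The union is too large to be \<open>k\<close>-connected under \<open>small\<close>, so
  fewer than \<open>k\<close> vertices separate the two sets in colour \<open>c\<close>.\<close>

lemma separator:
  assumes "kconn_on k (E c) A" "kconn_on k (E c) B" "A \<subseteq> V" "B \<subseteq> V"
    "card V < 2 * card (A \<union> B) + k"
  obtains S where "finite S" "card S < k" "\<And>a b. a \<in> A - S \<Longrightarrow> b \<in> B - S \<Longrightarrow> (a, b) \<notin> E c"
    "\<And>a b. a \<in> A - S \<Longrightarrow> b \<in> B - S \<Longrightarrow> (b, a) \<notin> E c"
proof -
  have "\<not> kconn_on k (E c) (A \<union> B)"
    using small[of "A \<union> B" c] assms(3-5) by auto
  then obtain S where "finite S" "card S < k" "\<And>a b. a \<in> A - S \<Longrightarrow> b \<in> B - S \<Longrightarrow> (a, b) \<notin> E c"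
    using kconn_on_Un_or_separator[OF assms(1,2) sym_E] by metis
  then show thesis using that[of S] symD[OF sym_E] by metis
qed

text \<open>Take a \<open>k\<close>-connected superset of greatest size; an outside vertex with
  \<open>k\<close> neighbours in it could be attached.\<close>

lemma maximal_extension:
  assumes "W \<subseteq> V" "kconn_on k (E c) W"
  obtains Q where "W \<subseteq> Q" "Q \<subseteq> V" "kconn_on k (E c) Q"
    "\<And>v. v \<in> V - Q \<Longrightarrow> card {u \<in> Q. (v, u) \<in> E c} < k"
proof -
  define P where "P Q \<longleftrightarrow> W \<subseteq> Q \<and> Q \<subseteq> V \<and> kconn_on k (E c) Q" for Q
  have "card Q < card V + 1" if "P Q" for Q
    using that card_mono[OF finite_V] unfolding P_def by (simp add: le_imp_less_Suc)
  moreover have "P W" using assms unfolding P_def by simp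
  ultimately obtain Q where Q: "P Q" and max: "\<And>R. P R \<Longrightarrow> card R \<le> card Q"
    using ex_has_greatest_nat[of P W card "card V + 1"] by (metis less_imp_le_nat)
  have "card {u \<in> Q. (v, u) \<in> E c} < k" if v: "v \<in> V - Q" for v
  proof (rule ccontr)
    assume "\<not> ?thesis"
    then have "kconn_on k (E c) (Q \<union> {v})"
      using Q sym_E unfolding P_def by (intro kconn_on_attach) auto
    then have "P (Q \<union> {v})" using Q v unfolding P_def by auto
    from max[OF this] show False using v Q fin[of Q] unfolding P_def by simp
  qed
  then show thesis using that[of Q] Q unfolding P_def by blast
qed

text \<open>Every vertex is attached to each of the four blocks in some colour. The only way to do this
  with two of the six components is to use both components of one colour, and fewer than \<open>k\<close>
  vertices can lie in both.\<close>

lemma no_four_blocks: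
  assumes pal: "palette r b g" and sub: "A1 \<subseteq> V" "A2 \<subseteq> V" "B1 \<subseteq> V" "B2 \<subseteq> V"
    and card: "3 * k \<le> card A1" "3 * k \<le> card A2" "3 * k \<le> card B1" "3 * k \<le> card B2"
    and red: "A1 \<times> A2 \<subseteq> E r" "B1 \<times> B2 \<subseteq> E r"
    and blue: "A1 \<times> B1 \<subseteq> E b" "A2 \<times> B2 \<subseteq> E b"
    and green: "A1 \<times> B2 \<subseteq> E g" "A2 \<times> B1 \<subseteq> E g"
    and large: "card V < 2 * card (A1 \<union> A2 \<union> B1 \<union> B2) + k"
  shows False
proof -
  \<comment> \<open>A bipartite pair of blocks together with every vertex that can be attached to it
    in its colour.\<close>
  define K where "K c X Y = X \<union> Y \<union> {v \<in> V. k \<le> card {u \<in> X \<union> Y. (v, u) \<in> E c}}" for c X Y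
  have KV: "K c X Y \<subseteq> V" if "X \<subseteq> V" "Y \<subseteq> V" for c X Y
    using that unfolding K_def by blast
  have conn: "kconn_on k (E c) (K c X Y)"
    if "X \<subseteq> V" "Y \<subseteq> V" "3 * k \<le> card X" "3 * k \<le> card Y" "X \<times> Y \<subseteq> E c" for c X Y
  proof -
    have "kconn_on k (E c) (X \<union> Y)"
      using that k_pos fin sym_E by (intro kconn_on_complete_bipartite) auto
    then show ?thesis unfolding K_def by (rule kconn_on_attach) (auto simp: finite_V sym_E)
  qed
  \<comment> \<open>Pigeonhole: outside \<open>A\<close>, a vertex is joined to at least
    \<open>3 * k\<close> vertices of \<open>A\<close> in three colours.\<close>
  have attach: "k \<le> card {u \<in> A. (v, u) \<in> E r} \<or> k \<le> card {u \<in> A. (v, u) \<in> E b}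
      \<or> k \<le> card {u \<in> A. (v, u) \<in> E g} \<or> v \<in> A"
    if "v \<in> V" "A \<subseteq> V" "3 * k \<le> card A" for v A
  proof (rule ccontr)
    assume *: "\<not> ?thesis"
    then have "A \<subseteq> {u \<in> A. (v, u) \<in> E r} \<union> {u \<in> A. (v, u) \<in> E b} \<union> {u \<in> A. (v, u) \<in> E g}"
      using paletteD[OF pal, of v] that by blast
    then have "card A \<le> card ({u \<in> A. (v, u) \<in> E r} \<union> {u \<in> A. (v, u) \<in> E b} \<union> {u \<in> A. (v, u) \<in> E g})"
      using fin[of A] that by (intro card_mono) auto
    also have "\<dots> \<le> card {u \<in> A. (v, u) \<in> E r} + card {u \<in> A. (v, u) \<in> E b} + card {u \<in> A. (v, u) \<in> E g}"
      by (meson add_le_mono card_Un_le le_refl le_trans)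
    finally show False using * that by linarith
  qed
  have KI: "v \<in> K c X Y"
    if "v \<in> V" "X \<subseteq> V" "Y \<subseteq> V" "k \<le> card {u \<in> A. (v, u) \<in> E c} \<or> v \<in> A" "A = X \<or> A = Y" for v c X Y A
  proof -
    have "card {u \<in> A. (v, u) \<in> E c} \<le> card {u \<in> X \<union> Y. (v, u) \<in> E c}"
      using that fin[of "X \<union> Y"] by (intro card_mono) auto
    then show ?thesis using that unfolding K_def by auto
  qed
  let ?R1 = "K r A1 A2" and ?R2 = "K r B1 B2" and ?B1 = "K b A1 B1" and ?B2 = "K b A2 B2"
    and ?G1 = "K g A1 B2" and ?G2 = "K g A2 B1"
  \<comment> \<open>Each block forces \<open>v\<close> into one of the three components built on it,
    and a component serves only two blocks. Two components suffice only if they are complementary,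
    hence of one colour, and then their intersection contributes the third unit.\<close>
  have count: "3 \<le> (of_bool (v \<in> ?R1) + of_bool (v \<in> ?R2) + of_bool (v \<in> ?B1) + of_bool (v \<in> ?B2)
      + of_bool (v \<in> ?G1) + of_bool (v \<in> ?G2) + of_bool (v \<in> ?R1 \<inter> ?R2) + of_bool (v \<in> ?B1 \<inter> ?B2)
      + of_bool (v \<in> ?G1 \<inter> ?G2) :: nat)" if v: "v \<in> V" for v
  proof -
    have "v \<in> ?R1 \<or> v \<in> ?B1 \<or> v \<in> ?G1"
      using attach[OF v sub(1) card(1)] KI[OF v] sub by blast
    moreover have "v \<in> ?R1 \<or> v \<in> ?B2 \<or> v \<in> ?G2"
      using attach[OF v sub(2) card(2)] KI[OF v] sub by blast
    moreover have "v \<in> ?R2 \<or> v \<in> ?B1 \<or> v \<in> ?G2"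
      using attach[OF v sub(3) card(3)] KI[OF v] sub by blast
    moreover have "v \<in> ?R2 \<or> v \<in> ?B2 \<or> v \<in> ?G1"
      using attach[OF v sub(4) card(4)] KI[OF v] sub by blast
    ultimately show ?thesis by (auto simp: of_bool_def)
  qed
  have card_sum: "card X = (\<Sum>v\<in>V. of_bool (v \<in> X))" if "X \<subseteq> V" for X
    using that finite_V by (simp add: of_bool_def sum.If_cases Int_absorb1)
  have sum: "3 * card V \<le> card ?R1 + card ?R2 + card ?B1 + card ?B2 + card ?G1 + card ?G2
      + card (?R1 \<inter> ?R2) + card (?B1 \<inter> ?B2) + card (?G1 \<inter> ?G2)"
  proof -
    have "3 * card V = (\<Sum>v\<in>V. 3)" by simp
    also have "\<dots> \<le> (\<Sum>v\<in>V. of_bool (v \<in> ?R1) + of_bool (v \<in> ?R2) + of_bool (v \<in> ?B1) + of_bool (v \<in> ?B2)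
      + of_bool (v \<in> ?G1) + of_bool (v \<in> ?G2) + of_bool (v \<in> ?R1 \<inter> ?R2) + of_bool (v \<in> ?B1 \<inter> ?B2)
      + of_bool (v \<in> ?G1 \<inter> ?G2))"
      by (intro sum_mono count)
    also have "\<dots> = card ?R1 + card ?R2 + card ?B1 + card ?B2 + card ?G1 + card ?G2
      + card (?R1 \<inter> ?R2) + card (?B1 \<inter> ?B2) + card (?G1 \<inter> ?G2)"
      using sub by (subst (1 2 3 4 5 6 7 8 9) card_sum) (auto simp only: sum.distrib KV le_infI1)
    finally show ?thesis .
  qed
  \<comment> \<open>Two complementary components contain all four blocks between them, so their
    union is too large to be \<open>k\<close>-connected.\<close>
  have overlap: "card (K c X Y \<inter> K c Z W) < k"
    if "kconn_on k (E c) (K c X Y)" "kconn_on k (E c) (K c Z W)" "X \<union> Y \<union> Z \<union> W = A1 \<union> A2 \<union> B1 \<union> B2"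
    for c X Y Z W
  proof (rule ccontr)
    assume "\<not> ?thesis"
    then have "kconn_on k (E c) (K c X Y \<union> K c Z W)"
      using that by (intro kconn_on_Un_overlap) auto
    moreover have KV': "K c X Y \<union> K c Z W \<subseteq> V"
      using that(3) sub KV[of X Y c] KV[of Z W c] by blast
    ultimately have "2 * card (K c X Y \<union> K c Z W) + k \<le> card V" by (rule small[rotated])
    moreover have "card (A1 \<union> A2 \<union> B1 \<union> B2) \<le> card (K c X Y \<union> K c Z W)"
      using that(3) fin[OF KV'] unfolding K_def by (intro card_mono) auto
    ultimately show False using large by linarith
  qed
  note comps = conn[OF sub(1,2) card(1,2) red(1)] conn[OF sub(3,4) card(3,4) red(2)]
    conn[OF sub(1,3) card(1,3) blue(1)] conn[OF sub(2,4) card(2,4) blue(2)]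
    conn[OF sub(1,4) card(1,4) green(1)] conn[OF sub(2,3) card(2,3) green(2)]
  have "card (?R1 \<inter> ?R2) < k" "card (?B1 \<inter> ?B2) < k" "card (?G1 \<inter> ?G2) < k"
    using overlap[OF comps(1,2)] overlap[OF comps(3,4)] overlap[OF comps(5,6)] by blast+
  moreover have "2 * card ?R1 + k \<le> card V" "2 * card ?R2 + k \<le> card V" "2 * card ?B1 + k \<le> card V"
    "2 * card ?B2 + k \<le> card V" "2 * card ?G1 + k \<le> card V" "2 * card ?G2 + k \<le> card V"
    using small[OF KV comps(1)] small[OF KV comps(2)] small[OF KV comps(3)] small[OF KV comps(4)]
      small[OF KV comps(5)] small[OF KV comps(6)] sub by blast+
  \<comment> \<open>The six components contribute at most \<open>3 * (card V - k)\<close> and the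
    three intersections at most \<open>3 * (k - 1)\<close>, in total less than
    \<open>3 * card V\<close>.\<close>
  ultimately show False using sum by linarith
qed

text \<open>The pairs \<open>(P2, Q1)\<close> and \<open>(P1, Q2)\<close> are almost entirely green.
  If \<open>P2\<close> or \<open>Q2\<close> is small, the blue set \<open>P1 \<union> Q1\<close>,
  alone or with one green set, is already too large. Otherwise separating green, blue and red pairs
  of sets in turn makes all six pairs of blocks complete in one colour each.\<close>

lemma no_two_by_two_partition:
  assumes pal: "palette r b g"
    and part: "V = P1 \<union> P2 \<union> Q1 \<union> Q2" "P1 \<inter> P2 = {}" "P1 \<inter> Q1 = {}" "P1 \<inter> Q2 = {}"
      "P2 \<inter> Q1 = {}" "P2 \<inter> Q2 = {}" "Q1 \<inter> Q2 = {}"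
    and red: "\<And>p. p \<in> P1 \<union> P2 \<Longrightarrow> card {q \<in> Q1 \<union> Q2. (p, q) \<in> E r} < k"
    and U: "kconn_on k (E b) (P1 \<union> Q1)"
    and blue: "\<And>p. p \<in> P2 \<Longrightarrow> card {q \<in> Q1. (p, q) \<in> E b} < k"
      "\<And>q. q \<in> Q2 \<Longrightarrow> card {p \<in> P1. (p, q) \<in> E b} < k"
    and large: "38 * k \<le> card P1" "38 * k \<le> card Q1"
  shows False
proof -
  have sub: "P1 \<subseteq> V" "P2 \<subseteq> V" "Q1 \<subseteq> V" "Q2 \<subseteq> V" unfolding part(1) by auto
  note finP = fin[OF sub(1)] fin[OF sub(2)] fin[OF sub(3)] fin[OF sub(4)]
  have n: "card V = card P1 + card P2 + card Q1 + card Q2"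
    unfolding part(1) using part finP by (intro card_Un4_disjoint) auto
  have cU: "card (P1 \<union> Q1) = card P1 + card Q1"
    using part finP by (intro card_Un_disjoint) auto
  have sU: "2 * card P1 + 2 * card Q1 + k \<le> card V"
    using small[OF _ U] sub cU by simp
  have red1: "card {q \<in> Q2. (p, q) \<in> E r} \<le> k" "card {q \<in> Q1. (p, q) \<in> E r} \<le> k"
    if "p \<in> P1 \<union> P2" for p
  proof -
    have "card {q \<in> Q2. (p, q) \<in> E r} \<le> card {q \<in> Q1 \<union> Q2. (p, q) \<in> E r}"
      "card {q \<in> Q1. (p, q) \<in> E r} \<le> card {q \<in> Q1 \<union> Q2. (p, q) \<in> E r}"
      using finP by (auto intro!: card_mono)
    then show "card {q \<in> Q2. (p, q) \<in> E r} \<le> k" "card {q \<in> Q1. (p, q) \<in> E r} \<le> k"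
      using red[OF that] by simp_all
  qed
  have pal': "(x, y) \<in> E r \<or> (x, y) \<in> E b \<or> (x, y) \<in> E g"
    if "x \<in> X" "y \<in> Y" "X \<subseteq> V" "Y \<subseteq> V" "X \<inter> Y = {}" for x y X Y
    using paletteD[OF pal, of x y] that by blast

  \<comment> \<open>Red and blue exceptions are both counted from \<open>P2\<close>, so
    \<open>r = 2 * k\<close> and \<open>r' = 0\<close>: vertices are lost only in
    \<open>Q1\<close>.\<close>
  have green_P2_Q1: "\<exists>Q\<subseteq>Q1. card (Q1 - Q) \<le> 8 * k \<and> kconn_on k (E g) (P2 \<union> Q)"
    if P2: "2 * k \<le> card P2"
  proof -
    have rb: "card {q \<in> Q1. (p, q) \<in> E r \<union> E b} \<le> 2 * k" if p: "p \<in> P2" for p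
    proof -
      have "{q \<in> Q1. (p, q) \<in> E r \<union> E b} = {q \<in> Q1. (p, q) \<in> E r} \<union> {q \<in> Q1. (p, q) \<in> E b}"
        by blast
      then have "card {q \<in> Q1. (p, q) \<in> E r \<union> E b}
          \<le> card {q \<in> Q1. (p, q) \<in> E r} + card {q \<in> Q1. (p, q) \<in> E b}"
        by (simp add: card_Un_le)
      then show ?thesis using red1(2)[of p] blue(1)[OF p] p by simp
    qed
    have cov: "(x, y) \<in> E g \<or> (x, y) \<in> E r \<union> E b \<or> (x, y) \<in> {}" if "x \<in> P2" "y \<in> Q1" for x y
      using pal'[OF that sub(2,3) part(5)] by blast
    obtain X Q where X: "X \<subseteq> P2" "card (P2 - X) \<le> 4 * 0" and Q: "Q \<subseteq> Q1" "card (Q1 - Q) \<le> 4 * (2 * k)"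
      "kconn_on k (E g) (X \<union> Q)"
      by (rule kconn_on_near_complete_bipartite[OF sym_E[of g] finP(2,3) k_pos cov rb, where r' = 0])
        (use P2 large in auto)
    have "X = P2" using X finP by (auto simp: card_eq_0_iff)
    then show ?thesis using Q by auto
  qed
  \<comment> \<open>Here red exceptions are counted from \<open>P1\<close> and blue ones from
    \<open>Q2\<close>, so both sides may lose \<open>4 * k\<close> vertices.\<close>
  have green_P1_Q2: "\<exists>P\<subseteq>P1. \<exists>Q\<subseteq>Q2. card (P1 - P) \<le> 4 * k \<and> card (Q2 - Q) \<le> 4 * k
      \<and> kconn_on k (E g) (P \<union> Q)" if "14 * k \<le> card Q2"
  proof -
    have bl: "card {p \<in> P1. (p, q) \<in> E b} \<le> k" if "q \<in> Q2" for q
      using blue(2)[OF that] by simp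
    have rd: "card {q \<in> Q2. (p, q) \<in> E r} \<le> k" if "p \<in> P1" for p
      using red1(1) that by blast
    have cov: "(x, y) \<in> E g \<or> (x, y) \<in> E r \<or> (x, y) \<in> E b" if "x \<in> P1" "y \<in> Q2" for x y
      using pal'[OF that sub(1,4) part(4)] by blast
    have sizes: "12 * k + 2 * k \<le> card Q2" "7 * k + 2 * k \<le> card P1" using that large by auto
    obtain P Q where "P \<subseteq> P1" "Q \<subseteq> Q2" "card (P1 - P) \<le> 4 * k" "card (Q2 - Q) \<le> 4 * k"
      "kconn_on k (E g) (P \<union> Q)"
      by (rule kconn_on_near_complete_bipartite[OF sym_E[of g] finP(1,4) k_pos cov rd bl sizes])
    then show ?thesis by blast
  qed

  consider "card P2 < 20 * k" "card Q2 < 20 * k" | "20 * k \<le> card P2" "card Q2 < 20 * k"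
    | "card P2 < 20 * k" "20 * k \<le> card Q2" | "20 * k \<le> card P2" "20 * k \<le> card Q2"
    by linarith
  then show False
  proof cases
    case 1
    then show False using sU n card_V k_pos by linarith
  next
    case 2
    then obtain Q where Q: "Q \<subseteq> Q1" "card (Q1 - Q) \<le> 8 * k" "kconn_on k (E g) (P2 \<union> Q)"
      using green_P2_Q1 by auto
    have "card (P2 \<union> Q) = card P2 + card Q"
      using part finP Q finite_subset[OF Q(1)] by (intro card_Un_disjoint) auto
    moreover have "P2 \<union> Q \<subseteq> V" using Q sub by blast
    ultimately have "2 * card P2 + 2 * card Q + k \<le> card V" using small[OF _ Q(3)] by simp
    moreover have "card Q1 = card Q + card (Q1 - Q)"
      using finP Q by (intro card_subset_add_card_Diff)
    ultimately show False using 2 Q sU n large k_pos by linarith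
  next
    case 3
    then obtain P Q where P: "P \<subseteq> P1" "card (P1 - P) \<le> 4 * k"
      and Q: "Q \<subseteq> Q2" "card (Q2 - Q) \<le> 4 * k" "kconn_on k (E g) (P \<union> Q)"
      using green_P1_Q2 by auto
    have "card (P \<union> Q) = card P + card Q"
      using part finP P Q finite_subset[OF Q(1)] finite_subset[OF P(1)] by (intro card_Un_disjoint) auto
    moreover have "P \<union> Q \<subseteq> V" using P Q sub by blast
    ultimately have "2 * card P + 2 * card Q + k \<le> card V" using small[OF _ Q(3)] by simp
    moreover have "card P1 = card P + card (P1 - P)" "card Q2 = card Q + card (Q2 - Q)"
      using finP P Q by (auto intro!: card_subset_add_card_Diff)
    ultimately show False using 3 P Q sU n large k_pos by linarith
  next
    case 4
    obtain Q1' where Q1': "Q1' \<subseteq> Q1" "card (Q1 - Q1') \<le> 8 * k" "kconn_on k (E g) (P2 \<union> Q1')"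
      using green_P2_Q1 4 by auto
    obtain P1' Q2' where P1': "P1' \<subseteq> P1" "card (P1 - P1') \<le> 4 * k"
      and Q2': "Q2' \<subseteq> Q2" "card (Q2 - Q2') \<le> 4 * k" "kconn_on k (E g) (P1' \<union> Q2')"
      using green_P1_Q2 4 by auto
    have finP': "finite P1'" "finite Q1'" "finite Q2'"
      using finite_subset[OF P1'(1) finP(1)] finite_subset[OF Q1'(1) finP(3)]
        finite_subset[OF Q2'(1) finP(4)] by auto
    have c1: "card P1 \<le> card P1' + 4 * k" "card Q1 \<le> card Q1' + 8 * k" "card Q2 \<le> card Q2' + 4 * k"
      using P1' Q1' Q2' card_subset_add_card_Diff[OF finP(1) P1'(1)]
        card_subset_add_card_Diff[OF finP(3) Q1'(1)] card_subset_add_card_Diff[OF finP(4) Q2'(1)] by linarith+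
    have "card ((P1' \<union> Q2') \<union> (P2 \<union> Q1')) = card (P1' \<union> Q2' \<union> P2 \<union> Q1')" by (simp add: Un_assoc)
    also have "\<dots> = card P1' + card Q2' + card P2 + card Q1'"
      using finP finP' P1'(1) Q1'(1) Q2'(1) part by (intro card_Un4_disjoint) auto
    finally have cg: "card V < 2 * card ((P1' \<union> Q2') \<union> (P2 \<union> Q1')) + k"
      using c1 n card_V k_pos by linarith
    have "P1' \<union> Q2' \<subseteq> V" "P2 \<union> Q1' \<subseteq> V" using sub P1'(1) Q1'(1) Q2'(1) by auto
    \<comment> \<open>First cut: the two green sets miss at most \<open>16 * k\<close> vertices of
      \<open>V\<close>, so they are separated in green.\<close>
    then obtain S where S: "finite S" "card S < k"
      and no_g: "\<And>x y. x \<in> P1' \<union> Q2' - S \<Longrightarrow> y \<in> P2 \<union> Q1' - S \<Longrightarrow> (x, y) \<notin> E g"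
        "\<And>x y. x \<in> P1' \<union> Q2' - S \<Longrightarrow> y \<in> P2 \<union> Q1' - S \<Longrightarrow> (y, x) \<notin> E g"
      by (rule separator[OF Q2'(3) Q1'(3) _ _ cg]) blast

    have c2: "card P2 \<le> card (P2 - S) + k" "card Q2' \<le> card (Q2' - S) + k"
      using S card_le_card_Diff_add by auto
    \<comment> \<open>With green excluded, only red exceptions remain between \<open>P2 - S\<close>
      and \<open>Q2' - S\<close>. This yields a second blue set, disjoint from
      \<open>P1 \<union> Q1\<close>.\<close>
    have cov: "(x, y) \<in> E b \<or> (x, y) \<in> E r \<or> (x, y) \<in> {}" if "x \<in> P2 - S" "y \<in> Q2' - S" for x y
      using pal'[of x P2 y Q2] no_g(2)[of y x] that sub part(6) Q2'(1) by blast
    have red2: "card {q \<in> Q2' - S. (p, q) \<in> E r} \<le> k" if "p \<in> P2 - S" for p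
    proof -
      have "card {q \<in> Q2' - S. (p, q) \<in> E r} \<le> card {q \<in> Q2. (p, q) \<in> E r}"
        using finP Q2'(1) by (intro card_mono) auto
      then show ?thesis using red1(1)[of p] that by simp
    qed
    have fin': "finite (P2 - S)" "finite (Q2' - S)" using finP finP' by auto
    obtain X Q2b where X: "X \<subseteq> P2 - S" "card (P2 - S - X) \<le> 4 * 0"
      and Q2b: "Q2b \<subseteq> Q2' - S" "card (Q2' - S - Q2b) \<le> 4 * k" "kconn_on k (E b) (X \<union> Q2b)"
      by (rule kconn_on_near_complete_bipartite[OF sym_E[of b] fin' k_pos cov red2, where r' = 0])
        (use c1 c2 4 in auto)
    have "X = P2 - S" using X finP by (auto simp: card_eq_0_iff)
    with Q2b have U2: "kconn_on k (E b) ((P2 - S) \<union> Q2b)" by simp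
    have finQ2b: "finite Q2b" using Q2b(1) finP' finite_subset by blast
    have c3: "card (Q2' - S) \<le> card Q2b + 4 * k"
      using Q2b card_subset_add_card_Diff[of "Q2' - S" Q2b] finP' by simp
    have "card ((P1 \<union> Q1) \<union> ((P2 - S) \<union> Q2b)) = card (P1 \<union> Q1 \<union> (P2 - S) \<union> Q2b)" by (simp add: Un_assoc)
    also have "\<dots> = card P1 + card Q1 + card (P2 - S) + card Q2b"
      using finP finQ2b Q2b(1) Q2'(1) part by (intro card_Un4_disjoint) auto
    finally have cb: "card V < 2 * card ((P1 \<union> Q1) \<union> ((P2 - S) \<union> Q2b)) + k"
      using c1 c2 c3 n card_V k_pos by linarith
    have "P1 \<union> Q1 \<subseteq> V" "(P2 - S) \<union> Q2b \<subseteq> V" using sub Q2b(1) Q2'(1) by auto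
    \<comment> \<open>Second cut, between the two blue sets.\<close>
    then obtain T where T: "finite T" "card T < k"
      and no_b: "\<And>x y. x \<in> P1 \<union> Q1 - T \<Longrightarrow> y \<in> (P2 - S) \<union> Q2b - T \<Longrightarrow> (x, y) \<notin> E b"
        "\<And>x y. x \<in> P1 \<union> Q1 - T \<Longrightarrow> y \<in> (P2 - S) \<union> Q2b - T \<Longrightarrow> (y, x) \<notin> E b"
      by (rule separator[OF U U2 _ _ cb]) blast

    define A1 where "A1 = P1' - S - T"
    define A2 where "A2 = P2 - S - T"
    define B1 where "B1 = Q1' - S - T"
    define B2 where "B2 = Q2b - T"
    have sub': "A1 \<subseteq> P1" "A2 \<subseteq> P2" "B1 \<subseteq> Q1" "B2 \<subseteq> Q2"
      unfolding A1_def A2_def B1_def B2_def using P1'(1) Q1'(1) Q2'(1) Q2b(1) by auto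
    have subV: "A1 \<subseteq> V" "A2 \<subseteq> V" "B1 \<subseteq> V" "B2 \<subseteq> V" using sub sub' by auto
    note finA = fin[OF subV(1)] fin[OF subV(2)] fin[OF subV(3)] fin[OF subV(4)]
    \<comment> \<open>The green sets, the second blue set and the deletions of \<open>S\<close> and
      \<open>T\<close> cost at most \<open>28 * k\<close> vertices in total.\<close>
    have c4: "card P1 \<le> card A1 + 6 * k" "card P2 \<le> card A2 + 2 * k" "card Q1 \<le> card B1 + 10 * k"
      "card Q2 \<le> card B2 + 10 * k"
      using c1 c2 c3 card_le_card_Diff_add[OF S, of P1'] card_le_card_Diff_add[OF S, of Q1']
        card_le_card_Diff_add[OF T, of "P1' - S"] card_le_card_Diff_add[OF T, of "P2 - S"]
        card_le_card_Diff_add[OF T, of "Q1' - S"] card_le_card_Diff_add[OF T, of Q2b]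
      unfolding A1_def A2_def B1_def B2_def by linarith+
    have in_g: "A1 \<union> B2 \<subseteq> P1' \<union> Q2' - S" "A2 \<union> B1 \<subseteq> P2 \<union> Q1' - S"
      and in_b: "A1 \<union> B1 \<subseteq> P1 \<union> Q1 - T" "A2 \<union> B2 \<subseteq> (P2 - S) \<union> Q2b - T"
      unfolding A1_def A2_def B1_def B2_def using P1'(1) Q1'(1) Q2b(1) by auto
    have ng: "(x, y) \<notin> E g" "(y, x) \<notin> E g" if "x \<in> A1 \<union> B2" "y \<in> A2 \<union> B1" for x y
      using no_g[of x y] in_g that by auto
    have nb: "(x, y) \<notin> E b" "(y, x) \<notin> E b" if "x \<in> A1 \<union> B1" "y \<in> A2 \<union> B2" for x y
      using no_b[of x y] in_b that by auto
    have disj: "A1 \<inter> A2 = {}" "A1 \<inter> B1 = {}" "A1 \<inter> B2 = {}" "A2 \<inter> B1 = {}" "A2 \<inter> B2 = {}" "B1 \<inter> B2 = {}"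
      using sub' part by blast+
    \<comment> \<open>The blocks of each of these two pairs lie on opposite sides of both the green
      and the blue cut, which leaves only red.\<close>
    have redA: "A1 \<times> A2 \<subseteq> E r"
      using pal'[OF _ _ subV(1,2) disj(1)] ng nb by blast
    have redB: "B1 \<times> B2 \<subseteq> E r"
      using pal'[OF _ _ subV(3,4) disj(6)] ng nb by blast
    have "kconn_on k (E r) (A1 \<union> A2)" "kconn_on k (E r) (B1 \<union> B2)"
      using c4 4 large k_pos finA redA redB sym_E by (auto intro!: kconn_on_complete_bipartite)
    moreover have "A1 \<union> A2 \<subseteq> V" "B1 \<union> B2 \<subseteq> V" using subV by auto
    moreover have cr: "card ((A1 \<union> A2) \<union> (B1 \<union> B2)) = card A1 + card A2 + card B1 + card B2"
    proof -
      have "card ((A1 \<union> A2) \<union> (B1 \<union> B2)) = card (A1 \<union> A2 \<union> B1 \<union> B2)" by (simp add: Un_assoc)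
      then show ?thesis using card_Un4_disjoint[OF finA disj] by simp
    qed
    moreover have "card V < 2 * card ((A1 \<union> A2) \<union> (B1 \<union> B2)) + k"
      using cr c4 n card_V k_pos by linarith
    \<comment> \<open>Third cut, between the two red sets. Each of the other four pairs is now
      crossed by the red cut and by exactly one of the green and blue cuts, so one colour is
      left.\<close>
    ultimately obtain R where R: "finite R" "card R < k"
      and no_r: "\<And>x y. x \<in> A1 \<union> A2 - R \<Longrightarrow> y \<in> B1 \<union> B2 - R \<Longrightarrow> (x, y) \<notin> E r"
      using separator by metis
    show False
    proof (rule no_four_blocks[OF pal, of "A1 - R" "A2 - R" "B1 - R" "B2 - R"])
      note c5 = card_le_card_Diff_add[OF R, of A1] card_le_card_Diff_add[OF R, of A2]
        card_le_card_Diff_add[OF R, of B1] card_le_card_Diff_add[OF R, of B2]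
      show "3 * k \<le> card (A1 - R)" "3 * k \<le> card (A2 - R)" "3 * k \<le> card (B1 - R)" "3 * k \<le> card (B2 - R)"
        using c4 c5 4 large by linarith+
      show "(A1 - R) \<times> (A2 - R) \<subseteq> E r" "(B1 - R) \<times> (B2 - R) \<subseteq> E r"
        using redA redB by auto
      show "(A1 - R) \<times> (B1 - R) \<subseteq> E b"
        using pal'[OF _ _ subV(1,3) disj(2)] ng no_r by blast
      show "(A2 - R) \<times> (B2 - R) \<subseteq> E b"
        using pal'[OF _ _ subV(2,4) disj(5)] ng no_r by blast
      show "(A1 - R) \<times> (B2 - R) \<subseteq> E g"
        using pal'[OF _ _ subV(1,4) disj(3)] nb no_r by blast
      show "(A2 - R) \<times> (B1 - R) \<subseteq> E g"
        using pal'[OF _ _ subV(2,3) disj(4)] nb no_r by blast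
      have "card ((A1 - R) \<union> (A2 - R) \<union> (B1 - R) \<union> (B2 - R))
          = card (A1 - R) + card (A2 - R) + card (B1 - R) + card (B2 - R)"
        using finA disj by (intro card_Un4_disjoint) auto
      then show "card V < 2 * card ((A1 - R) \<union> (A2 - R) \<union> (B1 - R) \<union> (B2 - R)) + k"
        using c4 c5 n card_V k_pos by linarith
    qed (use subV in auto)
  qed
qed

text \<open>Mader's theorem in the blue bipartite graph between \<open>Q\<close> and its complement
  gives a blue \<open>k\<close>-connected set meeting both sides substantially. A maximal extension
  \<open>U\<close> of it cuts both sides into the required four parts.\<close>

lemma no_maximal_kconn:
  assumes pal: "palette r b g" and Q: "Q \<subseteq> V" "156 * k \<le> card Q"
    and red: "\<And>v. v \<in> V - Q \<Longrightarrow> card {u \<in> Q. (v, u) \<in> E r} < k"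
    and dense: "76 * k * card V \<le> 2 * card (E b \<inter> (V - Q) \<times> Q)"
  shows False
proof -
  define P where "P = V - Q"
  \<comment> \<open>Symmetrising doubles the number of arcs, which accounts for the factor 2 in the
    density hypothesis.\<close>
  define F where "F = E b \<inter> P \<times> Q \<union> (E b \<inter> P \<times> Q)\<inverse>"
  have finPQ: "finite P" "finite Q" unfolding P_def using finite_V fin[OF Q(1)] by auto
  have FE: "F \<subseteq> E b" unfolding F_def using symD[OF sym_E] by auto
  have "card F = 2 * card (E b \<inter> P \<times> Q)"
  proof -
    have "card F = card (E b \<inter> P \<times> Q) + card ((E b \<inter> P \<times> Q)\<inverse>)"
      unfolding F_def using finPQ by (intro card_Un_disjoint) (auto simp: P_def)
    then show ?thesis by simp
  qed
  moreover have "F \<inter> V \<times> V = F" unfolding F_def P_def using Q by blast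
  ultimately have F_dense: "76 * k * card V \<le> card (F \<inter> V \<times> V)" using dense unfolding P_def by simp
  have F: "sym F" "(v, v) \<notin> F" for v
    using FE irrefl_E unfolding F_def by (auto intro!: symI)
  have sizes: "4 * k \<le> 76 * k" "2 * k \<le> card V" using card_V by auto
  obtain W where W: "W \<subseteq> V" "kconn_on k F W"
    and deg: "\<And>v. v \<in> W \<Longrightarrow> 76 * k < 2 * card {u \<in> W. (v, u) \<in> F}"
    by (rule mader_highly_connected_subgraph[OF finite_V F k_pos sizes F_dense]) blast
  obtain U where U: "W \<subseteq> U" "U \<subseteq> V" "kconn_on k (E b) U"
    and max: "\<And>v. v \<in> V - U \<Longrightarrow> card {u \<in> U. (v, u) \<in> E b} < k"
    using maximal_extension[OF W(1) kconn_on_mono[OF W(2) FE]] by metis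
  have finU: "finite U" using fin[OF U(2)] .
  \<comment> \<open>\<open>F\<close> is bipartite, so the more than \<open>38 * k\<close> neighbours
    of a vertex of \<open>P\<close> within \<open>W\<close> all lie in \<open>Q\<close>.\<close>
  have Q1: "38 * k < card (U \<inter> Q)" if "v \<in> W" "v \<in> P" for v
  proof -
    have "{u \<in> W. (v, u) \<in> F} \<subseteq> U \<inter> Q" using that U(1) unfolding F_def P_def by auto
    then have "card {u \<in> W. (v, u) \<in> F} \<le> card (U \<inter> Q)" using finU by (intro card_mono) auto
    then show ?thesis using deg[OF that(1)] by linarith
  qed
  have P1: "38 * k < card (U \<inter> P)" if "v \<in> W" "v \<in> Q" for v
  proof -
    have "{u \<in> W. (v, u) \<in> F} \<subseteq> U \<inter> P" using that U(1) unfolding F_def P_def by auto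
    then have "card {u \<in> W. (v, u) \<in> F} \<le> card (U \<inter> P)" using finU by (intro card_mono) auto
    then show ?thesis using deg[OF that(1)] by linarith
  qed
  have nbr: "\<exists>u\<in>W. (v, u) \<in> F" if "v \<in> W" for v
  proof (rule ccontr)
    assume "\<not> ?thesis"
    then have empty: "{u \<in> W. (v, u) \<in> F} = {}" by blast
    show False using deg[OF that] unfolding empty by simp
  qed
  have "W \<noteq> {}" using kconn_on_card[OF W(2)] by auto
  then obtain v where v: "v \<in> W" by blast
  then obtain u where u: "u \<in> W" "(v, u) \<in> F" using nbr by blast
  then have "v \<in> P \<and> u \<in> Q \<or> v \<in> Q \<and> u \<in> P" unfolding F_def by auto
  then have large: "38 * k < card (U \<inter> P)" "38 * k < card (U \<inter> Q)"
    using P1 Q1 v u by blast+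
  show False
  proof (rule no_two_by_two_partition[OF pal, of "U \<inter> P" "P - U" "U \<inter> Q" "Q - U"])
    show "V = U \<inter> P \<union> (P - U) \<union> U \<inter> Q \<union> (Q - U)" unfolding P_def using Q(1) by blast
    have "U \<inter> Q \<union> (Q - U) = Q" by blast
    then show "card {q \<in> U \<inter> Q \<union> (Q - U). (p, q) \<in> E r} < k" if "p \<in> U \<inter> P \<union> (P - U)" for p
      using red[of p] that unfolding P_def by auto
    have "U \<inter> P \<union> U \<inter> Q = U" unfolding P_def using U by blast
    then show "kconn_on k (E b) (U \<inter> P \<union> U \<inter> Q)" using U by simp
    show "card {q \<in> U \<inter> Q. (p, q) \<in> E b} < k" if "p \<in> P - U" for p
    proof -
      have "card {q \<in> U \<inter> Q. (p, q) \<in> E b} \<le> card {u \<in> U. (p, u) \<in> E b}"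
        using finU by (intro card_mono) auto
      then show ?thesis using max[of p] that unfolding P_def by auto
    qed
    show "card {p \<in> U \<inter> P. (p, q) \<in> E b} < k" if "q \<in> Q - U" for q
    proof -
      have "card {p \<in> U \<inter> P. (p, q) \<in> E b} \<le> card {u \<in> U. (q, u) \<in> E b}"
        using finU symD[OF sym_E] by (intro card_mono) auto
      then show ?thesis using max[of q] that Q by auto
    qed
    show "38 * k \<le> card (U \<inter> P)" "38 * k \<le> card (U \<inter> Q)" using large by simp_all
  qed (auto simp: P_def)
qed

text \<open>A dense colour has a maximal \<open>k\<close>-connected set \<open>Q\<close> with at
  least \<open>156 * k\<close> vertices. At most \<open>k\<close> red arcs per outside vertex lead
  into \<open>Q\<close>, so at least \<open>155 * k\<close> are blue or green. As at least half of
  \<open>V\<close> lies outside \<open>Q\<close>, one of these two colours is dense enough for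
  \<open>no_maximal_kconn\<close>.\<close>

lemma not_dense:
  assumes pal: "palette r b g"
  shows "card (E r \<inter> V \<times> V) < 159 * k * card V"
proof (rule ccontr)
  assume "\<not> ?thesis"
  then have dense: "159 * k * card V \<le> card (E r \<inter> V \<times> V)" by simp
  have sizes: "4 * k \<le> 159 * k" "2 * k \<le> card V" using card_V by auto
  obtain W where W: "W \<subseteq> V" "kconn_on k (E r) W"
    and deg: "\<And>v. v \<in> W \<Longrightarrow> 159 * k < 2 * card {u \<in> W. (v, u) \<in> E r}"
    and arcs: "159 * k * card W < card (E r \<inter> W \<times> W) + 159 * k * k"
    by (rule mader_highly_connected_subgraph[OF finite_V sym_E irrefl_E k_pos sizes dense]) blast
  have finW: "finite W" using fin[OF W(1)] .
  \<comment> \<open>For smaller \<open>W\<close>, the arc count gives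
    \<open>card W < 53 * k\<close>, while the minimum degree forces more than \<open>79 * k\<close>
    vertices.\<close>
  have cW: "156 * k \<le> card W"
  proof (rule ccontr)
    assume *: "\<not> ?thesis"
    have "W \<noteq> {}" using kconn_on_card[OF W(2)] by auto
    then obtain v where v: "v \<in> W" by blast
    have "card {u \<in> W. (v, u) \<in> E r} \<le> card W" using finW by (intro card_mono) auto
    then have half: "159 * k < 2 * card W" using deg[OF v] by linarith
    have "card (E r \<inter> W \<times> W) \<le> card (W \<times> W)" using finW by (intro card_mono) auto
    then have "159 * k * card W < card W * card W + 159 * k * k"
      using arcs by (simp add: card_cartesian_product)
    also have "card W * card W \<le> 156 * k * card W" using * by (intro mult_right_mono) auto
    finally have "3 * k * card W < 159 * k * k" by (simp add: algebra_simps)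
    then have "card W < 53 * k" by (simp add: algebra_simps)
    then show False using half by linarith
  qed
  obtain Q where Q: "W \<subseteq> Q" "Q \<subseteq> V" "kconn_on k (E r) Q"
    and max: "\<And>v. v \<in> V - Q \<Longrightarrow> card {u \<in> Q. (v, u) \<in> E r} < k"
    using maximal_extension[OF W] by metis
  have finQ: "finite Q" using fin[OF Q(2)] .
  have "card W \<le> card Q" using Q finQ by (intro card_mono)
  then have cQ: "156 * k \<le> card Q" using cW by linarith
  have cP: "card V = card Q + card (V - Q)" using Q finite_V by (intro card_subset_add_card_Diff)
  have "card (E r \<inter> (V - Q) \<times> Q) \<le> k * card (V - Q)"
  proof -
    have "E r \<inter> (V - Q) \<times> Q = (SIGMA v : V - Q. {u \<in> Q. (v, u) \<in> E r})" by auto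
    then have "card (E r \<inter> (V - Q) \<times> Q) = (\<Sum>v\<in>V - Q. card {u \<in> Q. (v, u) \<in> E r})"
      using finite_V finQ by (simp add: card_SigmaI)
    also have "\<dots> \<le> (\<Sum>v\<in>V - Q. k)" using max by (intro sum_mono) (simp add: less_imp_le)
    finally show ?thesis by (simp add: mult.commute)
  qed
  moreover have "card (V - Q) * card Q
      \<le> card (E r \<inter> (V - Q) \<times> Q) + card (E b \<inter> (V - Q) \<times> Q) + card (E g \<inter> (V - Q) \<times> Q)"
  proof -
    have "(V - Q) \<times> Q \<subseteq> E r \<inter> (V - Q) \<times> Q \<union> E b \<inter> (V - Q) \<times> Q \<union> E g \<inter> (V - Q) \<times> Q"
      using paletteD[OF pal] Q(2) by blast
    then have "card ((V - Q) \<times> Q)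
        \<le> card (E r \<inter> (V - Q) \<times> Q \<union> E b \<inter> (V - Q) \<times> Q \<union> E g \<inter> (V - Q) \<times> Q)"
      using finite_V finQ by (intro card_mono) auto
    also have "\<dots> \<le> card (E r \<inter> (V - Q) \<times> Q) + card (E b \<inter> (V - Q) \<times> Q) + card (E g \<inter> (V - Q) \<times> Q)"
      by (meson add_le_mono card_Un_le le_refl le_trans)
    finally show ?thesis by (simp add: card_cartesian_product)
  qed
  moreover have "card (V - Q) * (156 * k) \<le> card (V - Q) * card Q" using cQ by simp
  moreover have "76 * k * card V \<le> 155 * k * card (V - Q)"
  proof -
    have "card V \<le> 2 * card (V - Q)" using small[OF Q(2,3)] cP by linarith
    then have "76 * k * card V \<le> 76 * k * (2 * card (V - Q))" by (rule mult_le_mono2)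
    also have "\<dots> \<le> 155 * k * card (V - Q)" by simp
    finally show ?thesis .
  qed
  moreover have "card (V - Q) * (156 * k) = 155 * k * card (V - Q) + k * card (V - Q)" by simp
  ultimately have "76 * k * card V \<le> card (E b \<inter> (V - Q) \<times> Q) + card (E g \<inter> (V - Q) \<times> Q)"
    by linarith
  then consider "76 * k * card V \<le> 2 * card (E b \<inter> (V - Q) \<times> Q)"
    | "76 * k * card V \<le> 2 * card (E g \<inter> (V - Q) \<times> Q)" by linarith
  then show False
  proof cases
    case 1
    then show False using no_maximal_kconn[OF pal Q(2) cQ max] by simp
  next
    case 2
    moreover have "palette r g b" using pal unfolding palette_def by blast
    ultimately show False using no_maximal_kconn[OF _ Q(2) cQ max] by simp
  qed
qed

text \<open>Three colours that are each not dense have fewer than \<open>477 * k * card V\<close>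
  arcs together, whereas the complete graph has at least \<open>479 * k * card V\<close>.\<close>

lemma no_palette: "\<not> palette r b g"
proof
  assume pal: "palette r b g"
  then have pal': "palette b r g" "palette g r b" unfolding palette_def by blast+
  have "V \<times> V - Id \<subseteq> E r \<inter> V \<times> V \<union> E b \<inter> V \<times> V \<union> E g \<inter> V \<times> V"
    using paletteD[OF pal] by blast
  then have "card (V \<times> V - Id) \<le> card (E r \<inter> V \<times> V \<union> E b \<inter> V \<times> V \<union> E g \<inter> V \<times> V)"
    using finite_V by (intro card_mono) auto
  also have "\<dots> \<le> card (E r \<inter> V \<times> V) + card (E b \<inter> V \<times> V) + card (E g \<inter> V \<times> V)"
    by (meson add_le_mono card_Un_le le_refl le_trans)
  finally have 1: "card (V \<times> V - Id) \<le> \<dots>" .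
  have "V \<times> V \<subseteq> (V \<times> V - Id) \<union> (\<lambda>v. (v, v)) ` V" by auto
  then have "card (V \<times> V) \<le> card ((V \<times> V - Id) \<union> (\<lambda>v. (v, v)) ` V)"
    using finite_V by (intro card_mono) auto
  also have "\<dots> \<le> card (V \<times> V - Id) + card V"
    using finite_V by (meson add_le_mono card_Un_le card_image_le le_refl le_trans)
  finally have "card V * card V \<le> card (V \<times> V - Id) + card V" by (simp add: card_cartesian_product)
  moreover have "480 * k * card V \<le> card V * card V" using card_V by simp
  moreover have "card V \<le> k * card V" using k_pos by simp
  ultimately show False
    using 1 not_dense[OF pal] not_dense[OF pal'(1)] not_dense[OF pal'(2)] by linarith
qed

end

section \<open>Monochromatic subgraphs of the complete graph\<close>

text \<open>The vertices reachable from \<open>u\<close> inside \<open>A\<close> form a set with no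
  arc leaving it within \<open>A\<close>; conversely, a path inside \<open>A\<close> cannot leave
  such a set.\<close>

lemma conn_on_iff_rtrancl_on:
  "conn_on E A \<longleftrightarrow> (\<forall>u\<in>A. \<forall>v\<in>A. (u, v) \<in> rtrancl_on A E)"
proof (intro iffI ballI conn_onI)
  fix u v assume conn: "conn_on E A" and uv: "u \<in> A" "v \<in> A"
  define X where "X = {w. (u, w) \<in> rtrancl_on A E}"
  have XA: "X \<subseteq> A" unfolding X_def using in_rtrancl_on_in_F by fast
  have uX: "u \<in> X" unfolding X_def using uv by simp
  have "X = A"
  proof (rule ccontr)
    assume "X \<noteq> A"
    then obtain x y where xy: "x \<in> X" "y \<in> A - X" "(x, y) \<in> E"
      using conn_onE[OF conn XA] uX by blast
    then have "y \<in> X" unfolding X_def using rtrancl_on_into_rtrancl_on[of u x A E y] by simp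
    then show False using xy by blast
  qed
  then show "(u, v) \<in> rtrancl_on A E" using uv unfolding X_def by blast
next
  fix X assume all: "\<forall>u\<in>A. \<forall>v\<in>A. (u, v) \<in> rtrancl_on A E"
    and X: "X \<subseteq> A" "X \<noteq> {}" "X \<noteq> A" and no: "\<And>x y. x \<in> X \<Longrightarrow> y \<in> A - X \<Longrightarrow> (x, y) \<notin> E"
  obtain u where u: "u \<in> X" using X by blast
  obtain v where v: "v \<in> A" "v \<notin> X" using X by blast
  have "(u, v) \<in> rtrancl_on A E" using all u v X by blast
  then have "v \<in> X"
  proof (induction rule: rtrancl_on_induct)
    case base
    show ?case by (rule u)
  next
    case (step y z)
    then show ?case using no[of y z] by blast
  qed
  then show False using v by blast
qed

lemma conn_on_Restr:
  assumes "B \<subseteq> A"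
  shows "conn_on (E \<inter> A \<times> A) B \<longleftrightarrow> conn_on E B"
proof
  show "conn_on (E \<inter> A \<times> A) B \<Longrightarrow> conn_on E B" by (rule conn_on_mono) auto
  show "conn_on (E \<inter> A \<times> A) B" if conn: "conn_on E B"
  proof (rule conn_onI)
    fix X assume X: "X \<subseteq> B" "X \<noteq> {}" "X \<noteq> B"
      and no: "\<And>x y. x \<in> X \<Longrightarrow> y \<in> B - X \<Longrightarrow> (x, y) \<notin> E \<inter> A \<times> A"
    from conn_onE[OF conn X] obtain x y where "x \<in> X" "y \<in> B - X" "(x, y) \<in> E" .
    then show False using no[of x y] X(1) assms by auto
  qed
qed

lemma kconn_on_Restr: "kconn_on k (E \<inter> A \<times> A) A \<longleftrightarrow> kconn_on k E A"
  unfolding kconn_on_def by (simp add: conn_on_Restr)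

lemma connected_induce_subgraph_iff:
  assumes "pair_graph H"
  shows "Digraph_Component.connected (with_proj H \<restriction> A) \<longleftrightarrow> A \<noteq> {} \<and> conn_on (parcs H) A"
proof -
  interpret pair_graph H by fact
  have "(v, u) \<in> parcs H" if "(u, v) \<in> parcs H" for u v
    using that arcs_symmetric by simp
  then have "(arcs_ends (with_proj H \<restriction> A))\<^sup>s = parcs H \<inter> A \<times> A"
    unfolding symcl_def arcs_ends_conv by (auto simp: image_iff)
  then have "Digraph_Component.connected (with_proj H \<restriction> A) \<longleftrightarrow> A \<noteq> {} \<and> conn_on (parcs H \<inter> A \<times> A) A"
    unfolding connected_conv conn_on_iff_rtrancl_on by simp
  then show ?thesis by (simp add: conn_on_Restr)
qed

text \<open>The two notions of connectivity differ only on the empty set, and deleting fewer than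
  \<open>k\<close> of more than \<open>k\<close> vertices never empties the graph.\<close>

lemma k_connected_iff_kconn_on:
  assumes "pair_graph H" "1 \<le> k"
  shows "k_connected k (with_proj H) \<longleftrightarrow> kconn_on k (parcs H) (pverts H)"
proof -
  interpret pair_graph H by fact
  have "pverts H - S \<noteq> {}" if "k + 1 \<le> card (pverts H)" "S \<subseteq> pverts H" "card S < k" for S
    using that by (metis Diff_eq_empty_iff add_leD1 leD subset_antisym)
  then show ?thesis
    unfolding k_connected_def kconn_on_def connected_induce_subgraph_iff[OF assms(1)] by auto
qed

section \<open>Colour classes as relations\<close>

definition colour_arcs :: "nat \<Rightarrow> (nat set \<Rightarrow> nat) \<Rightarrow> nat \<Rightarrow> (nat \<times> nat) set" where
  "colour_arcs n f c = {(u, v). u < n \<and> v < n \<and> u \<noteq> v \<and> f {u, v} = c}"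

lemma sym_colour_arcs: "sym (colour_arcs n f c)"
  unfolding colour_arcs_def by (auto intro!: symI simp: insert_commute)

text \<open>The witness is the subgraph that colour \<open>c\<close> induces on
  \<open>W\<close>.\<close>

lemma max_mono_order_ge:
  assumes "1 \<le> k" "W \<subseteq> {..<n}" "kconn_on k (colour_arcs n f c) W"
  shows "card W \<le> max_mono_order n f k"
proof -
  define H where "H = \<lparr> pverts = W, parcs = colour_arcs n f c \<inter> W \<times> W \<rparr>"
  have "pair_graph H"
  proof
    have "finite W" using assms(2) finite_subset by blast
    then show "finite (pverts H)" "finite (parcs H)" unfolding H_def by auto
    show "symmetric (with_proj H)"
      using symD[OF sym_colour_arcs[of n f c]]
      unfolding symmetric_def arcs_ends_conv H_def by (auto intro!: symI simp: image_iff)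
  qed (auto simp: H_def colour_arcs_def)
  moreover have "wf_digraph (with_proj H)" "wf_digraph (with_proj (complete_graph n))"
    by unfold_locales (auto simp: H_def complete_graph_def)
  then have "subgraph (with_proj H) (with_proj (complete_graph n))"
    using assms(2) unfolding subgraph_def
    by (auto simp: H_def complete_graph_def colour_arcs_def)
  moreover have "monochromatic f H"
    unfolding monochromatic_def edges_def H_def by (auto simp: colour_arcs_def)
  moreover have "k_connected k (with_proj H)"
    using k_connected_iff_kconn_on[OF \<open>pair_graph H\<close> assms(1)] assms(3) unfolding H_def
    by (simp add: kconn_on_Restr)
  ultimately have "H \<in> mono_k_connected_subgraphs n f k"
    unfolding mono_k_connected_subgraphs_def by blast
  then have "card (pverts H) \<le> max_mono_order n f k"
    unfolding max_mono_order_def by (intro Max_ge finite_max_mono_order_set) auto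
  then show ?thesis unfolding H_def by simp
qed

text \<open>Adding arcs preserves \<open>k\<close>-connectivity, so a monochromatic subgraph may be
  replaced by its whole colour class on the same vertices.\<close>

lemma max_mono_order_le:
  assumes "1 \<le> k" "\<And>W c. W \<subseteq> {..<n} \<Longrightarrow> kconn_on k (colour_arcs n f c) W \<Longrightarrow> card W \<le> M"
  shows "max_mono_order n f k \<le> M"
proof -
  have "card (pverts H) \<le> M" if "H \<in> mono_k_connected_subgraphs n f k" for H
  proof -
    have H: "pair_graph H" "subgraph (with_proj H) (with_proj (complete_graph n))"
      "monochromatic f H" "k_connected k (with_proj H)"
      using that unfolding mono_k_connected_subgraphs_def by blast+
    obtain c where c: "\<forall>e\<in>edges H. f e = c" using H(3) unfolding monochromatic_def by blast
    have sub: "pverts H \<subseteq> {..<n}" "parcs H \<subseteq> parcs (complete_graph n)"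
      using H(2) unfolding subgraph_def by (auto simp: complete_graph_def)
    have "parcs H \<subseteq> colour_arcs n f c"
      using sub(2) c unfolding colour_arcs_def edges_def complete_graph_def by auto
    moreover have "kconn_on k (parcs H) (pverts H)"
      using k_connected_iff_kconn_on[OF H(1) assms(1)] H(4) by simp
    ultimately show ?thesis using assms(2)[OF sub(1)] kconn_on_mono by blast
  qed
  then show ?thesis
    unfolding max_mono_order_def by (subst Max_le_iff[OF finite_max_mono_order_set]) auto
qed

lemma max_mono_order_lower_bound:
  assumes "1 \<le> k" "480 * k \<le> n" "f \<in> edge_colourings 3 (complete_graph n)"
  shows "n + 1 \<le> 2 * max_mono_order n f k + k"
proof (rule ccontr)
  assume "\<not> ?thesis"
  then have small: "2 * max_mono_order n f k + k \<le> n" by simp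
  interpret no_large_kconn "{..<n}" "colour_arcs n f" k
  proof
    show "2 * card W + k \<le> card {..<n}"
      if "W \<subseteq> {..<n}" "kconn_on k (colour_arcs n f c) W" for W c
      using max_mono_order_ge[OF assms(1) that] small by simp
  qed (use assms sym_colour_arcs in \<open>auto simp: colour_arcs_def\<close>)
  have "f {u, v} \<in> {1..3}" if "u < n" "v < n" "u \<noteq> v" for u v
  proof -
    have "{u, v} \<in> edges (complete_graph n)"
      using that unfolding edges_def complete_graph_def by auto
    then show ?thesis using assms(3) unfolding edge_colourings_def by (rule PiE_mem[rotated])
  qed
  then have "palette 1 2 3"
    unfolding palette_def colour_arcs_def by force
  then show False using no_palette by blast
qed

lemma m1_ge:
  assumes "1 \<le> r" "\<And>f. f \<in> edge_colourings r (complete_graph n) \<Longrightarrow> M \<le> max_mono_order n f k"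
  shows "M \<le> m1 n r k"
  unfolding m1_def
  using assms edge_colourings_nonempty[OF assms(1)] finite_edge_colourings_complete_graph
  by (subst Min_ge_iff) auto

lemma m1_le: "f \<in> edge_colourings r (complete_graph n) \<Longrightarrow> m1 n r k \<le> max_mono_order n f k"
  unfolding m1_def using finite_edge_colourings_complete_graph by (intro Min_le) auto

section \<open>The extremal colouring\<close>

text \<open>
  The vertices below \<open>3 * m\<close>, with \<open>m = k - 1\<close>, form the three exceptional classes; the others are
  divided into four blocks modulo 4. For each colour \<open>c\<close>, \<open>block_pair c\<close> is one of the three ways to
  pair up the blocks. The value \<open>arc_colour m u v\<close> is only meaningful for \<open>u < v\<close>, and
  \<open>4 - u div m - v div m\<close> is the colour belonging to neither of two distinct exceptional classes.
\<close>

definition block_pair :: "nat \<Rightarrow> nat \<Rightarrow> nat" where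
  "block_pair c i = (if c = 1 then i div 2 else if c = 2 then i mod 2 else if i \<in> {0, 3} then 0 else 1)"

definition arc_colour :: "nat \<Rightarrow> nat \<Rightarrow> nat \<Rightarrow> nat" where
  "arc_colour m u v =
     (if v < 3 * m then if u div m = v div m then u div m + 1 else 4 - u div m - v div m
      else if u < 3 * m then u div m + 1
      else if block_pair 1 ((u - 3 * m) mod 4) = block_pair 1 ((v - 3 * m) mod 4) then 1
      else if block_pair 2 ((u - 3 * m) mod 4) = block_pair 2 ((v - 3 * m) mod 4) then 2
      else 3)"

text \<open>\<open>Min\<close> and \<open>Max\<close> put the endpoints in order, and
  \<open>restrict\<close> supplies the extensionality demanded by
  \<open>edge_colourings\<close>.\<close>

definition extremal_colouring :: "nat \<Rightarrow> nat \<Rightarrow> nat set \<Rightarrow> nat" where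
  "extremal_colouring m n = restrict (\<lambda>e. arc_colour m (Min e) (Max e)) (edges (complete_graph n))"

lemma arc_colour_range:
  assumes "u < v"
  shows "arc_colour m u v \<in> {1..3}"
proof -
  have div: "x div m \<le> 2" if "x < 3 * m" for x
    using less_mult_imp_div_less[OF that] by simp
  show ?thesis
  proof (cases "v < 3 * m")
    case True
    then have "u div m \<le> 2" "v div m \<le> 2" using div assms by auto
    \<comment> \<open>Distinct class indices among 0, 1, 2 have sum at most 3, so the truncated
      subtraction gives a colour of at least 1.\<close>
    then have "u div m = v div m \<or> u div m + v div m \<le> 3" by linarith
    then show ?thesis using True \<open>v div m \<le> 2\<close> unfolding arc_colour_def by auto
  next
    case False
    then show ?thesis using div[of u] unfolding arc_colour_def by auto
  qed
qed

lemma extremal_colouring_edge: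
  assumes "u < v" "v < n"
  shows "extremal_colouring m n {u, v} = arc_colour m u v"
proof -
  have "(u, v) \<in> parcs (complete_graph n)"
    using assms by (simp add: complete_graph_def)
  then have "{u, v} \<in> edges (complete_graph n)" unfolding edges_def by blast
  then show ?thesis using assms unfolding extremal_colouring_def by (simp add: min_def max_def)
qed

lemma extremal_colouring_mem: "extremal_colouring m n \<in> edge_colourings 3 (complete_graph n)"
  unfolding edge_colourings_def
proof
  show "extremal_colouring m n e \<in> {1..3}" if e: "e \<in> edges (complete_graph n)" for e
  proof -
    obtain u v where "e = {u, v}" "u < v" "v < n"
    proof -
      obtain a b where "e = {a, b}" "a < n" "b < n" "a \<noteq> b"
        using e unfolding edges_def complete_graph_def by auto
      then show thesis using that[of a b] that[of b a] by (metis insert_commute linorder_neqE_nat)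
    qed
    then show ?thesis using extremal_colouring_edge arc_colour_range by metis
  qed
qed (simp add: extremal_colouring_def)

text \<open>The components of colour \<open>c\<close> left after deleting the \<open>c\<close>-th exceptional class.\<close>

definition component_label :: "nat \<Rightarrow> nat \<Rightarrow> nat \<Rightarrow> nat" where
  "component_label m c v = (if v < 3 * m then 0 else Suc (block_pair c ((v - 3 * m) mod 4)))"

lemma less_4_cases: "(i::nat) < 4 \<Longrightarrow> i = 0 \<or> i = 1 \<or> i = 2 \<or> i = 3"
  by linarith

text \<open>Two exceptional vertices share label 0. An arc from an exceptional vertex to a block has
  the colour of its exceptional class, which is excluded. Between blocks, the colour names the
  pairing that puts both blocks together.\<close>

lemma component_label_eq:
  assumes "u < v" "arc_colour m u v = c" "u \<notin> {(c - 1) * m..<c * m}"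
  shows "component_label m c u = component_label m c v"
proof -
  consider "v < 3 * m" | "u < 3 * m" "3 * m \<le> v" | "3 * m \<le> u" "3 * m \<le> v" using assms(1) by linarith
  then show ?thesis
  proof cases
    case 1
    then show ?thesis using assms(1) unfolding component_label_def by simp
  next
    case 2
    then have "0 < m" by (cases m) auto
    have "c = u div m + 1" using 2 assms(2) unfolding arc_colour_def by simp
    moreover have "u div m * m \<le> u" "u < (u div m + 1) * m"
      using div_times_less_eq_dividend dividend_less_div_times[OF \<open>0 < m\<close>, of u] by (simp_all add: algebra_simps)
    ultimately show ?thesis using assms(3) by simp
  next
    case 3
    define i j where ij: "i = (u - 3 * m) mod 4" "j = (v - 3 * m) mod 4"
    have "i < 4" "j < 4" unfolding ij by simp_all
    from less_4_cases[OF this(1)] less_4_cases[OF this(2)] show ?thesis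
      using 3 assms(2) unfolding arc_colour_def component_label_def block_pair_def ij[symmetric]
      by (elim disjE) auto
  qed
qed

lemma conn_on_label_const:
  assumes "conn_on E A" "\<And>x y. x \<in> A \<Longrightarrow> y \<in> A \<Longrightarrow> (x, y) \<in> E \<Longrightarrow> \<phi> x = \<phi> y" "a \<in> A" "b \<in> A"
  shows "\<phi> a = \<phi> b"
proof (rule ccontr)
  assume "\<phi> a \<noteq> \<phi> b"
  then have "{x \<in> A. \<phi> x = \<phi> a} \<subseteq> A" "{x \<in> A. \<phi> x = \<phi> a} \<noteq> {}" "{x \<in> A. \<phi> x = \<phi> a} \<noteq> A"
    using assms(3,4) by (blast, blast, metis (mono_tags, lifting) mem_Collect_eq)
  then obtain x y where "x \<in> {x \<in> A. \<phi> x = \<phi> a}" "y \<in> A - {x \<in> A. \<phi> x = \<phi> a}" "(x, y) \<in> E"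
    by (rule conn_onE[OF assms(1)])
  then show False using assms(2)[of x y] by auto
qed

section \<open>Component sizes in the extremal colouring\<close>

lemma card_residue_class: "i < 4 \<Longrightarrow> card {y. y < N \<and> y mod 4 = i} = (N + 3 - i) div (4::nat)"
proof (induction N)
  case (Suc N)
  have fin: "finite {y. y < N \<and> y mod 4 = i}" by simp
  have "Suc (N + 3 - i) mod 4 = 0 \<longleftrightarrow> N mod 4 = i"
    using less_4_cases[OF Suc.prems] by (elim disjE) (simp_all, presburger+)
  moreover have "Suc N + 3 - i = Suc (N + 3 - i)" using Suc.prems by simp
  ultimately have step: "(Suc N + 3 - i) div 4 = (if N mod 4 = i then Suc ((N + 3 - i) div 4) else (N + 3 - i) div 4)"
    by (simp add: div_Suc)
  show ?case
  proof (cases "N mod 4 = i")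
    case True
    then have "{y. y < Suc N \<and> y mod 4 = i} = insert N {y. y < N \<and> y mod 4 = i}"
      by (auto simp: less_Suc_eq)
    then have "card {y. y < Suc N \<and> y mod 4 = i} = Suc ((N + 3 - i) div 4)" using Suc fin by simp
    then show ?thesis unfolding step using True by simp
  next
    case False
    then have "{y. y < Suc N \<and> y mod 4 = i} = {y. y < N \<and> y mod 4 = i}"
      by (auto simp: less_Suc_eq)
    then have "card {y. y < Suc N \<and> y mod 4 = i} = (N + 3 - i) div 4" using Suc by simp
    then show ?thesis unfolding step using False by simp
  qed
qed simp

text \<open>At most two residues modulo 4 occur in a part of a pairing, and their classes are
  counted exactly.\<close>

lemma card_block_pair:
  "2 * card {y. y < N \<and> block_pair c (y mod 4) = p} \<le> N + 2"
proof -
  have two: "2 * card {y. y < N \<and> block_pair c (y mod 4) = p} \<le> N + 2"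
    if "\<And>x. x < 4 \<Longrightarrow> block_pair c x = p \<Longrightarrow> x = i \<or> x = j" "i < 4" "j < 4" "i \<noteq> j" for i j
  proof -
    have "{y. y < N \<and> block_pair c (y mod 4) = p} \<subseteq> {y. y < N \<and> y mod 4 = i} \<union> {y. y < N \<and> y mod 4 = j}"
    proof
      fix y assume "y \<in> {y. y < N \<and> block_pair c (y mod 4) = p}"
      then show "y \<in> {y. y < N \<and> y mod 4 = i} \<union> {y. y < N \<and> y mod 4 = j}"
        using that(1)[of "y mod 4"] by simp
    qed
    then have "card {y. y < N \<and> block_pair c (y mod 4) = p}
        \<le> card ({y. y < N \<and> y mod 4 = i} \<union> {y. y < N \<and> y mod 4 = j})"
      by (intro card_mono) auto
    also have "\<dots> \<le> card {y. y < N \<and> y mod 4 = i} + card {y. y < N \<and> y mod 4 = j}"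
      by (rule card_Un_le)
    also have "\<dots> = (N + 3 - i) div 4 + (N + 3 - j) div 4"
      by (simp only: card_residue_class that(2,3))
    finally have "card {y. y < N \<and> block_pair c (y mod 4) = p} \<le> (N + 3 - i) div 4 + (N + 3 - j) div 4" .
    \<comment> \<open>Distinct residues have sum at least 1, which improves \<open>2 * N + 6\<close>
      to \<open>2 * N + 5\<close>; rounding then yields \<open>N + 2\<close> instead of
      \<open>N + 3\<close>.\<close>
    moreover have "4 * a + 4 * b \<le> 2 * N + 5" if "a * 4 + i \<le> N + 3" "b * 4 + j \<le> N + 3" for a b
    proof -
      have "1 \<le> i + j" using \<open>i \<noteq> j\<close> by simp
      then show ?thesis using that by simp
    qed
    moreover have "(N + 3 - i) div 4 * 4 + i \<le> N + 3" "(N + 3 - j) div 4 * 4 + j \<le> N + 3"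
      using div_times_less_eq_dividend[of "N + 3 - i" 4] div_times_less_eq_dividend[of "N + 3 - j" 4]
        that(2,3) by linarith+
    ultimately have "4 * ((N + 3 - i) div 4) + 4 * ((N + 3 - j) div 4) \<le> 2 * N + 5"
      and "card {y. y < N \<and> block_pair c (y mod 4) = p} \<le> (N + 3 - i) div 4 + (N + 3 - j) div 4"
      by blast+
    then show ?thesis by linarith
  qed
  have "\<exists>i j. i < 4 \<and> j < 4 \<and> i \<noteq> j \<and> (\<forall>x<4. block_pair c x = p \<longrightarrow> x = i \<or> x = j)"
  proof -
    consider "c = 1" "p = 0" | "c = 1" "p \<noteq> 0" | "c = 2" "p = 0" | "c = 2" "p \<noteq> 0"
      | "c \<noteq> 1" "c \<noteq> 2" "p = 0" | "c \<noteq> 1" "c \<noteq> 2" "p \<noteq> 0" by blast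
    then show ?thesis
    proof cases
      case 1
      then show ?thesis unfolding block_pair_def
        by (intro exI[of _ 0] exI[of _ 1]) (auto dest!: less_4_cases)
    next
      case 2
      then show ?thesis unfolding block_pair_def
        by (intro exI[of _ 2] exI[of _ 3]) (auto dest!: less_4_cases)
    next
      case 3
      then show ?thesis unfolding block_pair_def
        by (intro exI[of _ 0] exI[of _ 2]) (auto dest!: less_4_cases)
    next
      case 4
      then show ?thesis unfolding block_pair_def
        by (intro exI[of _ 1] exI[of _ 3]) (auto dest!: less_4_cases)
    next
      case 5
      then show ?thesis unfolding block_pair_def
        by (intro exI[of _ 0] exI[of _ 3]) (auto dest!: less_4_cases)
    next
      case 6
      then show ?thesis unfolding block_pair_def
        by (intro exI[of _ 1] exI[of _ 2]) (auto dest!: less_4_cases)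
    qed
  qed
  then show ?thesis using two by blast
qed

text \<open>Deleting the exceptional class of colour \<open>c\<close>, at most \<open>m\<close>
  vertices, leaves \<open>W\<close> connected, so the component label is constant there. The rest
  lies either among the \<open>3 * m\<close> exceptional vertices or in one pair of blocks, with at
  most \<open>(n - 3 * m + 2) / 2\<close> vertices.\<close>

lemma extremal_colouring_bound:
  assumes "9 * m < n" "W \<subseteq> {..<n}" "kconn_on (Suc m) (colour_arcs n (extremal_colouring m n) c) W"
  shows "2 * card W + m \<le> n + 2"
proof -
  define S where "S = {(c - 1) * m..<c * m}"
  define E where "E = colour_arcs n (extremal_colouring m n) c"
  have finW: "finite W" using assms(2) finite_subset by blast
  have "card S = (c - (c - 1)) * m" unfolding S_def by (simp only: card_atLeastLessThan diff_mult_distrib)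
  also have "\<dots> \<le> m" by (cases c) auto
  finally have cS: "card S \<le> m" .
  have conn: "conn_on E (W - S)"
    using kconn_onD'[OF assms(3), of S] cS unfolding E_def S_def by simp
  have label: "component_label m c x = component_label m c y"
    if "x \<in> W - S" "y \<in> W - S" "(x, y) \<in> E" for x y
  proof -
    have "x \<noteq> y" "x < n" "y < n" and col: "extremal_colouring m n {x, y} = c"
      using that(3) unfolding E_def colour_arcs_def by auto
    then consider "x < y" | "y < x" by linarith
    then show ?thesis
    proof cases
      case 1
      then show ?thesis
        using component_label_eq[OF 1, of m c] col extremal_colouring_edge[OF 1 \<open>y < n\<close>] that(1) S_def by simp
    next
      case 2
      then show ?thesis
        using component_label_eq[OF 2, of m c] col extremal_colouring_edge[OF 2 \<open>x < n\<close>] that(2) S_def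
        by (simp add: insert_commute)
    qed
  qed
  have WS: "card W \<le> card (W - S) + m"
    using diff_card_le_card_Diff[of S W] cS by (simp add: S_def)
  have "card W \<ge> Suc m + 1" using kconn_on_card[OF assms(3)] by simp
  then obtain w where w: "w \<in> W - S" using WS by (metis card.empty add_0 all_not_in_conv Suc_n_not_le_n add_leD1 le_trans)
  have const: "component_label m c v = component_label m c w" if "v \<in> W - S" for v
    using conn_on_label_const[OF conn label that w] .
  show ?thesis
  proof (cases "w < 3 * m")
    case True
    then have "component_label m c w = 0" by (simp add: component_label_def)
    then have "component_label m c v = 0" if "v \<in> W - S" for v using const[OF that] by simp
    then have "W - S \<subseteq> {..<3 * m}" unfolding component_label_def by (metis lessThan_iff nat.distinct(1) subsetI)
    then have "card (W - S) \<le> 3 * m" using card_mono[of "{..<3 * m}" "W - S"] by simp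
    then show ?thesis using WS assms(1) by linarith
  next
    case False
    define p where "p = block_pair c ((w - 3 * m) mod 4)"
    have *: "3 * m \<le> v" "block_pair c ((v - 3 * m) mod 4) = p" if "v \<in> W - S" for v
      using const[OF that] False unfolding component_label_def p_def by (auto split: if_splits)
    have "W - S \<subseteq> (\<lambda>y. y + 3 * m) ` {y. y < n - 3 * m \<and> block_pair c (y mod 4) = p}"
    proof
      fix v assume v: "v \<in> W - S"
      then have "v < n" using assms(2) by auto
      then show "v \<in> (\<lambda>y. y + 3 * m) ` {y. y < n - 3 * m \<and> block_pair c (y mod 4) = p}"
        using *[OF v] by (intro image_eqI[of _ _ "v - 3 * m"]) auto
    qed
    then have "card (W - S) \<le> card {y. y < n - 3 * m \<and> block_pair c (y mod 4) = p}"
      by (rule surj_card_le[rotated]) simp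
    then have "2 * card (W - S) \<le> n - 3 * m + 2" using card_block_pair[of "n - 3 * m" c p] by linarith
    then show ?thesis using WS assms(1) by linarith
  qed
qed

theorem theorem1p3:
  fixes n k :: nat
  assumes "k \<ge> 1" and "n \<ge> 480 * k"
  shows "(real n - real k + 1) / 2 \<le> real (m1 n 3 k)
       \<and> real (m1 n 3 k) \<le> (real n - real k + 1) / 2 + 1"
proof
  \<comment> \<open>This is \<open>(n - k + 1) / 2\<close> rounded up, the least integer allowed by
    the lower bound.\<close>
  have "(n + 1 - k + 1) div 2 \<le> m1 n 3 k"
  proof (rule m1_ge)
    fix f assume "f \<in> edge_colourings 3 (complete_graph n)"
    from max_mono_order_lower_bound[OF assms this]
    show "(n + 1 - k + 1) div 2 \<le> max_mono_order n f k" by linarith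
  qed simp
  then have "n + 1 \<le> 2 * m1 n 3 k + k" using assms by linarith
  from of_nat_mono[OF this, where ?'a = real]
  show "(real n - real k + 1) / 2 \<le> real (m1 n 3 k)" by simp

  define m where "m = k - 1"
  have k: "k = Suc m" using assms(1) unfolding m_def by simp
  have "max_mono_order n (extremal_colouring m n) k \<le> (n + 2 - m) div 2"
  proof (rule max_mono_order_le[OF assms(1)])
    fix W c assume "W \<subseteq> {..<n}" "kconn_on k (colour_arcs n (extremal_colouring m n) c) W"
    then have "2 * card W + m \<le> n + 2"
      using assms(2) extremal_colouring_bound[of m n W c] unfolding k by simp
    then show "card W \<le> (n + 2 - m) div 2" by linarith
  qed
  then have "m1 n 3 k \<le> (n + 2 - m) div 2"
    using m1_le[OF extremal_colouring_mem, of n k m] by linarith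
  then have "2 * m1 n 3 k + k \<le> n + 3" using assms k by linarith
  from of_nat_mono[OF this, where ?'a = real]
  show "real (m1 n 3 k) \<le> (real n - real k + 1) / 2 + 1" by (simp add: field_simps)
qed

end
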